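(* Let $m \ge 3$ be an integer, and let $k,\ell$ be integers with $0 < k,\ell < \frac{m}{2}$, both coprime to $m$. Let $\beta, \beta' \in \mathbb{F}_{2^m}^*$ be such that the polynomials $X^{2^k+1} + X + \beta$ and $X^{2^\ell+1} + X + \beta'$ have no roots in $\mathbb{F}_{2^m}$. Then the two Taniguchi APN functions $f_{k,1,\beta}, f_{\ell,1,\beta'}\colon \mathbb{F}_{2^m}^2 \to \mathbb{F}_{2^m}^2$ given by $$f_{k,1,\beta}(x,y) = \left(x^{2^{2k}(2^k+1)} + x^{2^{2k}}y^{2^k} + \beta y^{2^k+1},\ xy\right)$$ and $$f_{\ell,1,\beta'}(x,y) = \left(x^{2^{2\ell}(2^\ell+1)} + x^{2^{2\ell}}y^{2^\ell} + \beta' y^{2^\ell+1},\ xy\right)$$ are CCZ-equivalent if and only if $k = \ell$ and $\beta' = \beta^{2^i}$ for some $i \in \{0,\dots,m-1\}$.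
   Context: The finite field $\mathbb{F}_{2^{n}}$ is identified with the vector space $\mathbb{F}_2^n$, and $\mathbb{F}_{2^{2m}}$ with $\mathbb{F}_{2^m}^2=\mathbb{F}_{2^m}\times\mathbb{F}_{2^m}$ (as $\mathbb{F}_2$-vector spaces). A function $f$ on $\mathbb{F}_2^n$ is APN (almost perfect nonlinear) if for every $b$ and every nonzero $a$ the equation $f(x+a)+f(x)=b$ has exactly $0$ or $2$ solutions $x$. Two functions $f,g$ on $\mathbb{F}_2^n$ are CCZ-equivalent if there is an affine permutation $C$ (over $\mathbb{F}_2$) of $\mathbb{F}_{2}^n \times \mathbb{F}_{2}^n$ with $C(G_f)=G_g$, where $G_f=\{(x,f(x)) : x\in\mathbb{F}_2^n\}$ is the graph of $f$. By a theorem of Taniguchi, for $m\ge 2$, $\gcd(k,m)=1$, $\alpha,\beta\in\mathbb{F}_{2^m}$, $\beta\neq0$, the function $f_{k,\alpha,\beta}(x,y)=(x^{2^{2k}(2^k+1)}+\alpha x^{2^{2k}}y^{2^k}+\beta y^{2^k+1},\,xy)$ is APN if and only if $X^{2^k+1}+\alpha X+\beta$ has no root in $\mathbb{F}_{2^m}$. *)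

theory Defs
  imports
    "HOL-Library.Z2"
    "HOL-Library.Product_Plus"
    "HOL-Library.Cardinality"
    "HOL-Computational_Algebra.Polynomial"
begin

(* The type bit of HOL-Library.Z2 is the field with two elements. The scalar
   multiplication below is the only one that can make an abelian group a vector
   space over it; it does so exactly when x + x = 0 for all x
   (lemma vector_space_scale2). *)
definition scale2 :: "bit \<Rightarrow> 'v::ab_group_add \<Rightarrow> 'v" where
  "scale2 c v = (if c = 1 then v else 0)"

lemma vector_space_scale2:
  "vector_space (scale2 :: bit \<Rightarrow> 'v::ab_group_add \<Rightarrow> 'v) \<longleftrightarrow> (\<forall>x::'v. x + x = 0)"
proof
  assume "vector_space (scale2 :: bit \<Rightarrow> 'v \<Rightarrow> 'v)"
  then interpret vector_space "scale2 :: bit \<Rightarrow> 'v \<Rightarrow> 'v" .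
  show "\<forall>x::'v. x + x = 0"
  proof
    fix x :: 'v
    have "scale2 (1 + 1) x = scale2 1 x + scale2 1 x"
      by (rule scale_left_distrib)
    then show "x + x = 0" by (simp add: scale2_def)
  qed
next
  assume "\<forall>x::'v. x + x = 0"
  then show "vector_space (scale2 :: bit \<Rightarrow> 'v \<Rightarrow> 'v)"
    by unfold_locales (auto simp: scale2_def)
qed

lemma add_self_of_card_power2:
  fixes x :: "'a::{finite, field}"
  assumes "CARD('a) = 2 ^ m"
  shows "x + x = 0"
proof -
  have "(\<Sum>y\<in>UNIV. y + 1) = (\<Sum>y\<in>UNIV. (y::'a))"
    by (rule sum.reindex_bij_witness[where i = "\<lambda>y. y - 1" and j = "\<lambda>y. y + 1"]) auto
  then have "of_nat (2 ^ m) = (0::'a)"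
    using assms by (simp add: sum.distrib)
  then have "(2::'a) = 0"
    by simp
  then show ?thesis
    by (metis mult_2 mult_zero_left)
qed

lemma vector_space_scale2_field:
  assumes "CARD('a::{finite, field}) = 2 ^ m"
  shows "vector_space (scale2 :: bit \<Rightarrow> ('a \<times> 'a) \<times> ('a \<times> 'a) \<Rightarrow> _)"
  using add_self_of_card_power2[OF assms]
  by (auto simp: vector_space_scale2 zero_prod_def)

(* Vector_Spaces.linear includes the requirement that both sides are vector
   spaces, so this predicate is meant for groups with x + x = 0 only. *)
definition affine_permutation2 :: "('v::ab_group_add \<Rightarrow> 'v) \<Rightarrow> bool" where
  "affine_permutation2 C \<longleftrightarrow>
     bij C \<and> (\<exists>L c. Vector_Spaces.linear scale2 scale2 L \<and> C = (\<lambda>v. L v + c))"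

definition fun_graph :: "('v \<Rightarrow> 'w) \<Rightarrow> ('v \<times> 'w) set" where
  "fun_graph f = {(x, f x) | x. True}"

definition ccz_equivalent :: "('v::ab_group_add \<Rightarrow> 'v) \<Rightarrow> ('v \<Rightarrow> 'v) \<Rightarrow> bool" where
  "ccz_equivalent f g \<longleftrightarrow>
     (\<exists>C. affine_permutation2 C \<and> C ` fun_graph f = fun_graph g)"

definition taniguchi_poly :: "nat \<Rightarrow> 'a::field \<Rightarrow> 'a \<Rightarrow> 'a poly" where
  "taniguchi_poly k \<alpha> \<beta> = monom 1 (2 ^ k + 1) + monom \<alpha> 1 + monom \<beta> 0"

definition taniguchi :: "nat \<Rightarrow> 'a::field \<Rightarrow> 'a \<Rightarrow> 'a \<times> 'a \<Rightarrow> 'a \<times> 'a" where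
  "taniguchi k \<alpha> \<beta> = (\<lambda>(x, y).
     (x ^ (2 ^ (2 * k) * (2 ^ k + 1)) + \<alpha> * x ^ (2 ^ (2 * k)) * y ^ (2 ^ k) + \<beta> * y ^ (2 ^ k + 1),
      x * y))"

end

theory Submission
  imports Defs "HOL-Number_Theory.Cong"
begin

text \<open>
  Let \<open>f\<close>, \<open>g\<close> be the two functions, with polar forms \<open>B\<^sub>f\<close>, \<open>B\<^sub>g\<close>, and let an affine permutation
  map \<open>(v, f v)\<close> to \<open>(A v, g (A v))\<close>. Both \<open>A\<close> and \<open>g \<circ> A\<close> are quadratic, and the polar
  form \<open>\<beta>\<close> of \<open>A\<close> is \<open>T \<circ> B\<^sub>f\<close> for a linear map \<open>T\<close>. The components \<open>Tr(c x y)\<close> of \<open>f\<close> are bent while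
  those of the permutation \<open>A\<close> are balanced, so the range of \<open>T\<close> has at most \<open>2\<^sup>m\<close> elements.
  As \<open>g\<close> is APN, this forces \<open>\<beta> = 0\<close>: the maps \<open>A\<close> and \<open>g \<circ> A\<close> would otherwise be too
  degenerate. Hence \<open>B\<^sub>g (L u) (L v) = N (B\<^sub>f u v)\<close> for linear \<open>L\<close>, \<open>N\<close> with \<open>L\<close> bijective.

  Write \<open>L\<close> and \<open>N\<close> by linearized polynomials. For \<open>m > 3\<close>, comparing coefficients in the second component
  shows that \<open>L\<close> is an invertible matrix composed with a power of the Frobenius map. In the
  first component this matrix turns out to be diagonal, with \<open>k = l\<close>, and its two entries satisfy
  \<open>d = a\<close> to the power \<open>2\<^bsup>2l\<^esup>\<close>, which leaves \<open>\<beta>'\<close> conjugate to \<open>\<beta>\<close>. For \<open>m = 3\<close> only \<open>k = l = 1\<close> is possible,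
  and the admissible \<open>\<beta>\<close> are the three conjugate roots of \<open>X\<^sup>3 + X + 1\<close>.
\<close>

section \<open>Quadratic maps on elementary abelian 2-groups\<close>

lemma exponent2_simps:
  fixes x y :: "'v::ab_group_add"
  assumes "\<And>x::'v. x + x = 0"
  shows "x + x = 0" "x + (x + y) = y" "- x = x" "x - y = x + y"
proof -
  show "x + x = 0" by (rule assms)
  then show "x + (x + y) = y" by (simp flip: add.assoc)
  show "- x = x" using assms[of x] by (simp add: minus_unique)
  then show "x - y = x + y"
    using assms[of y] by (metis diff_conv_add_uminus minus_unique)
qed

lemma additive_zero:
  fixes f :: "'v::ab_group_add \<Rightarrow> 'w::ab_group_add"
  assumes "\<And>x y. f (x + y) = f x + f y"
  shows "f 0 = 0"
  using assms[of 0 0] by simp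

lemma card_kernel_times_card_range:
  fixes f :: "'v::{finite, ab_group_add} \<Rightarrow> 'w::ab_group_add"
  assumes add: "\<And>x y. f (x + y) = f x + f y"
  shows "CARD('v) = card {x. f x = 0} * card (range f)"
proof -
  have diff: "f (x - z) = f x - f z" for x z
    using add[of "x - z" z] by (simp add: eq_diff_eq)
  have fib: "card {x. f x = y} = card {x. f x = 0}" if y: "y \<in> range f" for y
  proof -
    obtain z where z: "y = f z" using y by blast
    have "bij_betw (\<lambda>x. x + z) {x. f x = 0} {x. f x = y}"
      by (rule bij_betw_byWitness[where f' = "\<lambda>x. x - z"])
        (use z diff in \<open>auto simp: add\<close>)
    then show ?thesis by (simp add: bij_betw_same_card)
  qed
  have "card (\<Union>y\<in>range f. {x. f x = y}) = (\<Sum>y\<in>range f. card {x. f x = y})"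
    by (rule card_UN_disjoint) auto
  also have "\<dots> = card (range f) * card {x. f x = 0}"
    using fib by simp
  also have "(\<Union>y\<in>range f. {x. f x = y}) = UNIV" by auto
  finally show ?thesis by simp
qed

text \<open>A subgroup maximal among those containing \<open>H\<close> and avoiding \<open>w\<close>
  has index two, because every vector outside it differs from \<open>w\<close> by an element of it.
  The final equivalence makes it the kernel of a character that is trivial on \<open>H\<close> and
  -1 at \<open>w\<close>.\<close>

lemma maximal_avoiding_subgroup:
  fixes H :: "'v::{finite, ab_group_add} set"
  assumes two: "\<And>x::'v. x + x = 0"
    and H0: "0 \<in> H" and Hadd: "\<And>x y. x \<in> H \<Longrightarrow> y \<in> H \<Longrightarrow> x + y \<in> H"
    and w: "w \<notin> H"
  obtains M where "H \<subseteq> M" "w \<notin> M"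
    "\<And>x y. x + y \<in> M \<longleftrightarrow> (x \<in> M \<longleftrightarrow> y \<in> M)"
proof -
  note s = exponent2_simps[OF two]
  let ?P = "\<lambda>M. H \<subseteq> M \<and> w \<notin> M \<and> (\<forall>x\<in>M. \<forall>y\<in>M. x + y \<in> M)"
  have "?P H" using Hadd w by blast
  moreover have "\<forall>N. ?P N \<longrightarrow> card N < Suc (CARD('v))"
    by (simp add: card_mono less_Suc_eq_le)
  ultimately have "\<exists>M. ?P M \<and> (\<forall>N. ?P N \<longrightarrow> card N \<le> card M)"
    by (rule ex_has_greatest_nat)
  then obtain M where M: "?P M" and max: "\<forall>N. ?P N \<longrightarrow> card N \<le> card M"
    by (elim exE conjE) blast
  have zero: "0 \<in> M" using M H0 by blast
  have cl: "x + y \<in> M" if "x \<in> M" "y \<in> M" for x y using M that by blast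
  \<comment> \<open>Otherwise \<open>M\<close> together with its translate by \<open>v\<close> would
    be a larger subgroup still avoiding \<open>w\<close>.\<close>
  have out: "v + w \<in> M" if v: "v \<notin> M" for v
  proof (rule ccontr)
    assume n: "v + w \<notin> M"
    let ?N = "{x. x \<in> M \<or> v + x \<in> M}"
    have "x + y \<in> ?N" if "x \<in> ?N" "y \<in> ?N" for x y
      using that cl[of x y] cl[of "v + x" y] cl[of x "v + y"] cl[of "v + x" "v + y"]
      by (auto simp: s add_ac)
    moreover have "w \<notin> ?N" using n M by blast
    moreover have "H \<subseteq> ?N" using M by blast
    ultimately have "?P ?N" by blast
    then have "card ?N \<le> card M" by (rule max[rule_format])
    then have "M = ?N" by (intro card_seteq) auto
    moreover have "v \<in> ?N" using zero s by simp
    ultimately show False using v by blast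
  qed
  have "x + y \<in> M \<longleftrightarrow> (x \<in> M \<longleftrightarrow> y \<in> M)" for x y
  proof (cases "x \<in> M")
    case True
    then show ?thesis using cl[of x y] cl[of x "x + y"] by (auto simp: s)
  next
    case False
    have "x + y \<in> M" if "y \<notin> M"
      using cl[OF out[OF False] out[OF that]] by (simp add: s add_ac)
    moreover have "y \<notin> M" if "x + y \<in> M"
      using cl[OF that, of y] False by (auto simp: s add_ac)
    ultimately show ?thesis using False by blast
  qed
  then show ?thesis using that M by blast
qed

text \<open>A bent function is not balanced: the square of its character sum is the group order.\<close>
lemma permutation_no_bent_component:
  fixes A :: "'v::{finite, ab_group_add} \<Rightarrow> 'v"
  assumes two: "\<And>x::'v. x + x = 0" and "bij A"
    and polar: "\<And>u v. A (u + v) = A u + A v + A 0 + \<beta> u v"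
    and add: "\<And>u v d. \<beta> (u + v) d = \<beta> u d + \<beta> v d"
    and H: "0 \<in> H" "\<And>x y. x \<in> H \<Longrightarrow> y \<in> H \<Longrightarrow> x + y \<in> H"
    and bent: "\<And>d. d \<noteq> 0 \<Longrightarrow> \<exists>v. \<beta> v d + w \<in> H"
  shows "w \<in> H"
proof (rule ccontr)
  note s = exponent2_simps[OF two]
  assume "w \<notin> H"
  then obtain M where HM: "H \<subseteq> M" and wM: "w \<notin> M"
    and M: "\<And>x y. x + y \<in> M \<longleftrightarrow> (x \<in> M \<longleftrightarrow> y \<in> M)"
    using maximal_avoiding_subgroup[OF two H] by metis
  \<comment> \<open>The sign character with kernel \<open>M\<close>.\<close>
  define \<chi> :: "'v \<Rightarrow> int" where "\<chi> x = (if x \<in> M then 1 else - 1)" for x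
  have mult: "\<chi> (x + y) = \<chi> x * \<chi> y" for x y using M by (auto simp: \<chi>_def)
  have zero: "0 \<in> M" using HM H by blast
  have vanish: "(\<Sum>x\<in>UNIV. \<chi> (f x)) = 0" if "\<And>x. \<chi> (f (x + z)) = - \<chi> (f x)"
    for f :: "'v \<Rightarrow> 'v" and z
  proof -
    have "(\<Sum>x\<in>UNIV. \<chi> (f x)) = (\<Sum>x\<in>UNIV. \<chi> (f (x + z)))"
      by (rule sum.reindex_bij_witness[of _ "\<lambda>x. x + z" "\<lambda>x. x - z"]) auto
    also have "\<dots> = - (\<Sum>x\<in>UNIV. \<chi> (f x))" using that by (simp add: sum_negf)
    finally show ?thesis by simp
  qed
  have "(\<Sum>v\<in>UNIV. \<chi> (A v)) = (\<Sum>x\<in>UNIV. \<chi> x)"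
    using \<open>bij A\<close> by (simp add: sum.reindex_bij_betw)
  also have "\<dots> = 0"
    using vanish[of "\<lambda>x. x" w] mult wM by (simp add: \<chi>_def)
  finally have "0 = (\<Sum>v\<in>UNIV. \<chi> (A v)) * (\<Sum>d\<in>UNIV. \<chi> (A d))" by simp
  also have "\<dots> = (\<Sum>v\<in>UNIV. \<Sum>d\<in>UNIV. \<chi> (A v) * \<chi> (A d))"
    by (rule sum_product)
  \<comment> \<open>After this shift the polar identity leaves only
    \<open>\<chi> (\<beta> v d)\<close> depending on \<open>v\<close>. Its sum over \<open>v\<close>
    vanishes unless \<open>d = 0\<close>.\<close>
  also have "\<dots> = (\<Sum>v\<in>UNIV. \<Sum>d\<in>UNIV. \<chi> (A v) * \<chi> (A (v + d)))"
  proof (rule sum.cong[OF refl])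
    fix v
    show "(\<Sum>d\<in>UNIV. \<chi> (A v) * \<chi> (A d)) = (\<Sum>d\<in>UNIV. \<chi> (A v) * \<chi> (A (v + d)))"
      by (rule sum.reindex_bij_witness[of _ "\<lambda>d. v + d" "\<lambda>d. d - v"]) auto
  qed
  also have "\<dots> = (\<Sum>d\<in>UNIV. \<Sum>v\<in>UNIV. \<chi> (A d + A 0) * \<chi> (\<beta> v d))"
  proof (subst sum.swap, intro sum.cong refl)
    fix v d
    show "\<chi> (A v) * \<chi> (A (v + d)) = \<chi> (A d + A 0) * \<chi> (\<beta> v d)"
      unfolding polar by (simp add: s add_ac flip: mult)
  qed
  also have "\<dots> = (\<Sum>d\<in>(UNIV :: 'v set). if d = 0 then int (CARD('v)) else 0)"
  proof (intro sum.cong refl)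
    fix d :: 'v
    show "(\<Sum>v\<in>UNIV. \<chi> (A d + A 0) * \<chi> (\<beta> v d)) = (if d = 0 then int (CARD('v)) else 0)"
    proof (cases "d = 0")
      case True
      have "\<beta> v 0 = 0" for v
        using polar[of v 0] by (simp add: s)
      then show ?thesis using True zero by (simp add: s \<chi>_def)
    next
      case False
      then obtain z where z: "\<beta> z d + w \<in> H" using bent by blast
      then have "\<chi> (\<beta> z d) = - 1" using HM wM M[of "\<beta> z d" w] by (auto simp: \<chi>_def)
      then have "(\<Sum>v\<in>UNIV. \<chi> (\<beta> v d)) = 0"
        by (intro vanish[of _ z]) (simp add: add mult)
      then show ?thesis using False by (simp flip: sum_distrib_left)
    qed
  qed
  also have "\<dots> = int (CARD('v))" by simp
  finally show False by simp
qed

text \<open>Vanishing of the third differences of \<open>g \<circ> A\<close>, together with APN-ness of \<open>g\<close>, makes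
  \<open>\<beta>\<close>-orthogonality transitive on nonzero vectors. The subgroups orthogonal to a vector therefore
  partition the space, and two distinct ones are too large to intersect trivially.\<close>
lemma quadratic_permutation_affine:
  fixes A g :: "'v::{finite, ab_group_add} \<Rightarrow> 'v"
  assumes two: "\<And>x::'v. x + x = 0" and "bij A"
    and polar: "\<And>u v. A (u + v) = A u + A v + A 0 + \<beta> u v"
    and add: "\<And>u v d. \<beta> (u + v) d = \<beta> u d + \<beta> v d"
    and g: "\<And>x y. g (x + y) = g x + g y + g 0 + B x y"
    and B_add: "\<And>x y e. B (x + y) e = B x e + B y e"
    and apn: "\<And>x e. B x e = 0 \<Longrightarrow> e \<noteq> 0 \<Longrightarrow> x = 0 \<or> x = e"
    and gA: "\<And>u v. g (A (u + v)) = g (A u) + g (A v) + g (A 0) + \<gamma> u v"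
    and \<gamma>_add: "\<And>u v d. \<gamma> (u + v) d = \<gamma> u d + \<gamma> v d"
    and W: "0 \<in> W" "\<And>u v. \<beta> u v \<in> W" "\<And>x y. x \<in> W \<Longrightarrow> y \<in> W \<Longrightarrow> x + y \<in> W"
    and card_W: "card W * card W \<le> CARD('v)" and large: "8 < CARD('v)"
  shows "\<beta> u v = 0"
proof -
  note s = exponent2_simps[OF two] add.assoc add.left_commute add.commute
  have inj: "A x = A y \<longleftrightarrow> x = y" for x y using \<open>bij A\<close> by (simp add: bij_def inj_eq)
  have sym: "\<beta> x y = \<beta> y x" for x y
    using polar[of x y] polar[of y x] by (simp add: s)
  have add': "\<beta> x (y + z) = \<beta> x y + \<beta> x z" for x y z
    using add[of y z x] by (simp add: sym)
  have \<beta>0: "\<beta> 0 x = 0" for x using additive_zero[of "\<lambda>y. \<beta> y x"] add by blast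
  \<comment> \<open>On \<open>u\<close> plus the vectors orthogonal to \<open>d\<close>, the
    difference of \<open>A\<close> in direction \<open>d\<close> is a constant
    \<open>\<omega>\<close>, and that of \<open>g \<circ> A\<close> is affine. Summing over the
    shifts \<open>0\<close>, \<open>v\<close>, \<open>v'\<close>, \<open>v + v'\<close> cancels the
    affine terms and leaves \<open>B (\<beta> v v') \<omega> = 0\<close>, to which the APN condition
    applies.\<close>
  have key: "\<beta> v v' = 0 \<or> \<beta> v v' = A d + A 0 + \<beta> u d"
    if vd: "\<beta> v d = 0" "\<beta> v' d = 0" and d: "d \<noteq> 0" for u v v' d
  proof -
    define \<omega> where "\<omega> = A d + A 0 + \<beta> u d"
    have shift: "A (u + t + d) = A (u + t) + \<omega>" if "\<beta> t d = 0" for t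
      unfolding polar[of "u + t" d] add \<omega>_def that by (simp add: s)
    have "\<omega> \<noteq> 0"
    proof
      assume "\<omega> = 0"
      then have "A (u + d) = A u" using shift[of 0] \<beta>0 by simp
      then show False using d inj by simp
    qed
    have diff: "B (A (u + t)) \<omega> = g \<omega> + g 0 + g (A d) + g (A 0) + \<gamma> u d + \<gamma> t d"
      if "\<beta> t d = 0" for t
    proof -
      have "B (A (u + t)) \<omega> = g (A (u + t)) + g \<omega> + g 0 + g (A (u + t) + \<omega>)"
        unfolding g by (simp add: s)
      also have "g (A (u + t) + \<omega>) = g (A (u + t)) + g (A d) + g (A 0) + (\<gamma> u d + \<gamma> t d)"
        using gA[of "u + t" d] by (simp add: shift[OF that] \<gamma>_add)
      finally show ?thesis by (simp add: s)
    qed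
    have eq: "\<beta> v v' = A (u + 0) + A (u + v) + A (u + v') + A (u + (v + v'))"
      unfolding polar[of u] polar[of v v'] add' by (simp add: s sym[of u 0] \<beta>0)
    have "\<gamma> 0 d = 0" using additive_zero[of "\<lambda>t. \<gamma> t d"] \<gamma>_add by blast
    then have "B (\<beta> v v') \<omega> = 0"
      using vd unfolding eq B_add
      by (subst (1 2 3 4) diff) (simp_all add: add \<gamma>_add \<beta>0 s)
    then show ?thesis using apn \<open>\<omega> \<noteq> 0\<close> \<omega>_def by blast
  qed
  \<comment> \<open>If transitivity fails at \<open>t\<close>, then \<open>key\<close> puts
    \<open>t\<close> in the radical and confines \<open>\<beta>\<close> to two values
    \<open>0\<close>, \<open>e\<close>. The map
    \<open>d \<mapsto> (\<beta> x d, \<beta> y d)\<close> then has kernel of size at most 2 and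
    range of size at most 4, against \<open>large\<close>.\<close>
  have trans: "\<beta> x y = 0" if xt: "\<beta> x t = 0" "\<beta> y t = 0" and t: "t \<noteq> 0" for x y t
  proof (rule ccontr)
    assume nz: "\<beta> x y \<noteq> 0"
    define e where "e = \<beta> x y"
    have e: "e = A t + A 0 + \<beta> u t" for u
      using key[OF xt t] nz e_def by blast
    then have rad: "\<beta> u t = 0" for u using e[of 0] e[of u] by (simp add: \<beta>0)
    have vals: "\<beta> a b \<in> {0, e}" for a b
      using key[OF rad rad t, of a b 0] e[of 0] by auto
    let ?f = "\<lambda>d. (\<beta> x d, \<beta> y d)"
    have "d = t" if "?f d = 0" "d \<noteq> 0" for d
    proof -
      have "e = A d + A 0" using key[of x d y 0] that nz e_def by (auto simp: zero_prod_def \<beta>0)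
      then show ?thesis using e[of 0] inj by (simp add: \<beta>0)
    qed
    then have "{d. ?f d = 0} \<subseteq> {0, t}" by blast
    then have k: "card {d. ?f d = 0} \<le> 2"
      using card_mono[of "{0, t}" "{d. ?f d = 0}"] t by simp
    have "range ?f \<subseteq> {0, e} \<times> {0, e}" using vals by auto
    then have "card (range ?f) \<le> card ({0, e} \<times> {0, e})" by (intro card_mono) auto
    also have "\<dots> = 4" using nz e_def by (simp add: card_cartesian_product)
    finally have "card (range ?f) \<le> 4" .
    with k have "card {d. ?f d = 0} * card (range ?f) \<le> 2 * 4" by (rule mult_le_mono)
    then show False
      using card_kernel_times_card_range[of ?f] large by (simp add: add')
  qed
  show ?thesis
  proof (rule ccontr)
    assume "\<beta> u v \<noteq> 0"
    then obtain w where w: "w \<in> W" "w \<noteq> 0" using W by blast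
    \<comment> \<open>For this \<open>z\<close>, \<open>A (x + z) = A x + w + \<beta> x z\<close>,
      so injectivity of \<open>A\<close> keeps \<open>w\<close> out of the range of
      \<open>\<lambda>x. \<beta> x z\<close>.\<close>
    obtain z where z: "A z = A 0 + w" using \<open>bij A\<close> by (metis bij_pointE)
    then have z0: "z \<noteq> 0" using w by auto
    obtain d where d: "\<beta> d z \<noteq> 0" using trans[OF _ _ z0] \<open>\<beta> u v \<noteq> 0\<close> by blast
    let ?N = "\<lambda>d. {x. \<beta> x d = 0}" and ?R = "\<lambda>d. range (\<lambda>x. \<beta> x d)"
    have count: "CARD('v) = card (?N d) * card (?R d)" for d
      by (rule card_kernel_times_card_range) (rule add)
    have "card (?R d) \<le> card W" using W by (intro card_mono) auto
    \<comment> \<open>The range and its translate by \<open>w\<close> are disjoint inside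
      \<open>W\<close>. This factor 2 is what makes the final count contradictory.\<close>
    moreover have "2 * card (?R z) \<le> card W"
    proof -
      have "w + \<beta> x z \<noteq> 0" for x
        using inj[of "x + z" x] z0 unfolding polar z by (auto simp: s)
      then have "w \<notin> ?R z" using two by (metis imageE)
      then have "?R z \<inter> (+) w ` ?R z = {}"
      proof (auto simp: s)
        fix x y assume "\<beta> x z = w + \<beta> y z"
        then have "w = \<beta> (x + y) z" by (simp add: add s)
        then show False using \<open>w \<notin> ?R z\<close> by blast
      qed
      then have "card (?R z \<union> (+) w ` ?R z) = card (?R z) + card (?R z)"
        by (simp add: card_Un_disjoint card_image)
      moreover have "?R z \<union> (+) w ` ?R z \<subseteq> W" using W w by auto
      ultimately show ?thesis by (metis card_mono finite mult_2)
    qed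
    ultimately have "card (?R d) * (2 * card (?R z)) \<le> CARD('v)"
      using card_W by (meson le_trans mult_le_mono)
    \<comment> \<open>By \<open>trans\<close>, a nonzero common element of the two kernels would
      give \<open>\<beta> d z = 0\<close>; so they meet trivially and their sum is direct.\<close>
    moreover have "card (?N d) * card (?N z) \<le> CARD('v)"
    proof -
      have "inj_on (\<lambda>(x, y). x + y) (?N d \<times> ?N z)"
      proof (rule inj_onI, clarsimp)
        fix x y x' y'
        assume h: "\<beta> x d = 0" "\<beta> y z = 0" "\<beta> x' d = 0" "\<beta> y' z = 0" "x + y = x' + y'"
        have "x + x' + (y + y') = (x + y) + (x' + y')" by (simp add: s)
    then have "x + x' + (y + y') = 0" using h(5) by (simp add: two)
    then have eq: "x + x' = y + y'" by (metis s(3) minus_unique)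
        have "\<beta> (x + x') d = 0" using h by (simp add: add)
        moreover have "\<beta> (x + x') z = 0" using h unfolding eq by (simp add: add)
        ultimately have "\<beta> d (x + x') = 0" "\<beta> z (x + x') = 0" by (simp_all add: sym)
        then have "x + x' = 0" using trans d by blast
        then show "x = x' \<and> y = y'" using eq by (metis s(3) minus_unique)
      qed
      then have "card (?N d \<times> ?N z) \<le> CARD('v)"
        by (metis card_image card_mono finite subset_UNIV)
      then show ?thesis by (simp add: card_cartesian_product)
    qed
    ultimately have "(card (?R d) * (2 * card (?R z))) * (card (?N d) * card (?N z)) \<le> CARD('v) * CARD('v)"
      by (rule mult_le_mono)
    moreover have "2 * (CARD('v) * CARD('v)) =
        2 * ((card (?N d) * card (?R d)) * (card (?N z) * card (?R z)))"
      by (simp flip: count)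
    ultimately have "2 * (CARD('v) * CARD('v)) \<le> CARD('v) * CARD('v)"
      by (simp add: mult_ac)
    then show False by simp
  qed
qed


section \<open>Linearized polynomials over a field of characteristic two\<close>

lemma card_power2_power_add:
  fixes x y :: "'a::{finite, field}"
  assumes "CARD('a) = 2 ^ m"
  shows "(x + y) ^ 2 ^ i = x ^ 2 ^ i + y ^ 2 ^ i"
proof (induction i)
  case (Suc i)
  have "(x + y) ^ 2 ^ Suc i = ((x + y) ^ 2 ^ i)\<^sup>2" by (simp add: power_mult mult.commute flip: power_mult)
  also have "\<dots> = (x ^ 2 ^ i)\<^sup>2 + (y ^ 2 ^ i)\<^sup>2 + (x ^ 2 ^ i * y ^ 2 ^ i + x ^ 2 ^ i * y ^ 2 ^ i)"
    unfolding Suc by (simp add: power2_eq_square algebra_simps)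
  finally show ?case
    using add_self_of_card_power2[OF assms] by (simp add: mult.commute flip: power_mult)
qed simp

lemma finite_field_power_card:
  fixes x :: "'a::{finite, field}"
  shows "x ^ CARD('a) = x"
proof (cases "x = 0")
  case False
  have "bij_betw ((*) x) (UNIV - {0}) (UNIV - {0})"
    by (rule bij_betw_byWitness[where f' = "\<lambda>y. y / x"]) (use False in auto)
  then have "(\<Prod>y\<in>UNIV - {0}. x * y) = \<Prod>(UNIV - {0})"
    by (rule prod.reindex_bij_betw)
  then have "x ^ (CARD('a) - 1) = 1"
    by (simp add: prod.distrib card_Diff_singleton)
  then show ?thesis
    by (metis finite_UNIV_card_ge_0 finite mult.right_neutral power_eq_if neq0_conv)
qed (simp add: power_0_left)

lemma not_cong_add:
  fixes c i j m :: nat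
  assumes "0 < c" "c < m" "i = j + c \<or> j = i + c"
  shows "\<not> [i = j] (mod m)"
  using assms by (auto simp: cong_0_iff cong_add_lcancel_0_nat cong_sym_eq[of _ "_ + _"] dest: nat_dvd_not_less)

context
  fixes m :: nat
  assumes card: "CARD('a::{finite, field}) = 2 ^ m"
begin

lemmas char2 = exponent2_simps[OF add_self_of_card_power2[OF card]]
lemmas frob_add = card_power2_power_add[OF card]

lemma m_pos: "0 < m"
proof -
  have "card {0, 1 :: 'a} \<le> CARD('a)" by (intro card_mono) auto
  then show ?thesis using card by (cases m) auto
qed

lemma frob_inj: "(x::'a) ^ 2 ^ i = y ^ 2 ^ i \<longleftrightarrow> x = y"
proof
  assume "x ^ 2 ^ i = y ^ 2 ^ i"
  then have "(x + y) ^ 2 ^ i = 0" by (simp add: frob_add char2)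
  then have "x + y = 0" by simp
  then show "x = y" by (metis char2(3) minus_unique)
qed simp

lemma frob_surj: "\<exists>y::'a. y ^ 2 ^ i = x"
proof -
  have "inj (\<lambda>y::'a. y ^ 2 ^ i)" by (simp add: inj_def frob_inj)
  then have "surj (\<lambda>y::'a. y ^ 2 ^ i)" by (simp add: finite_UNIV_inj_surj)
  then show ?thesis by (metis surjD)
qed

lemma frob_sum: "(\<Sum>j\<in>J. f j :: 'a) ^ 2 ^ i = (\<Sum>j\<in>J. f j ^ 2 ^ i)"
  by (induction J rule: infinite_finite_induct) (simp_all add: frob_add power_0_left)

lemma frob_mod: "(x::'a) ^ 2 ^ (i mod m) = x ^ 2 ^ i"
proof -
  have *: "x ^ 2 ^ (m * n) = x" for x :: 'a and n
    by (induction n) (simp_all add: power_add power_mult finite_field_power_card flip: card)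
  have "(2::nat) ^ i = 2 ^ (m * (i div m)) * 2 ^ (i mod m)"
    by (simp flip: power_add)
  then show ?thesis by (simp only: power_mult[of x] *)
qed

definition linpoly :: "(nat \<Rightarrow> 'a) \<Rightarrow> 'a \<Rightarrow> 'a" where
  "linpoly a x = (\<Sum>i<m. a i * x ^ 2 ^ i)"

lemma linpoly_add: "linpoly a (x + y) = linpoly a x + linpoly a y"
  by (simp add: linpoly_def frob_add algebra_simps sum.distrib)

text \<open>The degree is below \<open>2 ^ m\<close>, the number of roots, so the polynomial itself
  is zero. This is what permits comparing coefficients of additive maps.\<close>

lemma linpoly_eq_0:
  assumes "\<And>x. linpoly a x = 0" and i: "i < m"
  shows "a i = 0"
proof -
  define p where "p = (\<Sum>i<m. monom (a i) (2 ^ i))"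
  have deg: "degree p < 2 ^ m" unfolding p_def
    by (rule degree_sum_less) (auto intro: le_less_trans[OF degree_monom_le])
  have "poly p x = 0" for x
    using assms(1)[of x] by (simp add: p_def linpoly_def poly_sum poly_monom)
  then have "p = 0"
    using deg card by (intro poly_eqI_degree[of UNIV]) auto
  moreover have "coeff p (2 ^ i) = (\<Sum>j<m. if j = i then a j else 0)"
    unfolding p_def coeff_sum by (intro sum.cong) auto
  ultimately show ?thesis using i by simp
qed

text \<open>Squaring permutes the exponents \<open>2 ^ i\<close> cyclically, so it does not leave the linearized polynomials.\<close>
lemma linpoly_square: "\<exists>b. \<forall>x. (linpoly a x)\<^sup>2 = linpoly b x"
proof -
  \<comment> \<open>The predecessor modulo \<open>m\<close>; adding \<open>m - 1\<close> avoids
    truncated subtraction at 0.\<close>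
  let ?c = "\<lambda>i. (i + (m - 1)) mod m"
  have c: "Suc (?c i) mod m = i" "?c i < m" if "i < m" for i
    using that m_pos by (simp_all add: mod_Suc_eq)
  have c': "?c (Suc i mod m) = i" if "i < m" for i
  proof -
    have "?c (Suc i mod m) = (Suc i + (m - 1)) mod m" by (rule mod_add_left_eq)
    also have "Suc i + (m - 1) = i + m" using m_pos by simp
    finally show ?thesis using that by simp
  qed
  have "(linpoly a x)\<^sup>2 = linpoly (\<lambda>i. (a (?c i))\<^sup>2) x" for x
  proof -
    have "(linpoly a x)\<^sup>2 = (\<Sum>i<m. (a i)\<^sup>2 * x ^ 2 ^ Suc i)"
      using frob_sum[of "\<lambda>i. a i * x ^ 2 ^ i" "{..<m}" 1]
      by (simp add: linpoly_def power_mult_distrib power_mult mult.commute flip: power_mult)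
    also have "\<dots> = (\<Sum>i<m. (a i)\<^sup>2 * x ^ 2 ^ (Suc i mod m))"
      by (simp only: frob_mod)
    also have "\<dots> = (\<Sum>i<m. (a (?c i))\<^sup>2 * x ^ 2 ^ i)"
      by (rule sum.reindex_bij_witness[of _ ?c "\<lambda>i. Suc i mod m"])
        (use c c' m_pos in auto)
    finally show ?thesis by (simp add: linpoly_def)
  qed
  then show ?thesis by blast
qed

lemma linpoly_combine: "linpoly a x + t * linpoly b x = linpoly (\<lambda>i. a i + t * b i) x"
  by (simp add: linpoly_def sum_distrib_left sum.distrib algebra_simps)

text \<open>Interpolate the additive map on a maximal subgroup that is the kernel of a linearized
  polynomial \<open>p\<close>. If \<open>v\<close> lies outside, then \<open>p\<^sup>2 + p(v) p\<close> has a larger kernel, and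
  a multiple of \<open>p\<close> corrects the interpolant at \<open>v\<close>.\<close>
lemma additive_imp_linpoly:
  fixes h :: "'a \<Rightarrow> 'a"
  assumes add: "\<And>x y. h (x + y) = h x + h y"
  shows "\<exists>a. \<forall>x. h x = linpoly a x"
proof -
  let ?P = "\<lambda>H. (\<exists>p. H = {x. linpoly p x = 0}) \<and> (\<exists>r. \<forall>x\<in>H. h x = linpoly r x)"
  have "linpoly (\<lambda>i. if i = 0 then 1 else 0) x = x" for x
    using m_pos by (simp add: linpoly_def if_distrib[of "\<lambda>c. c * _"] cong: if_cong)
  then have "{0} = {x. linpoly (\<lambda>i. if i = 0 then 1 else 0) x = 0}" by simp
  moreover have "\<forall>x\<in>{0}. h x = linpoly (\<lambda>i. 0) x"
    using additive_zero[of h] add by (simp add: linpoly_def)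
  ultimately have "?P {0}" by blast
  moreover have "\<forall>H. ?P H \<longrightarrow> card H < Suc (CARD('a))"
    by (simp add: card_mono less_Suc_eq_le)
  ultimately have "\<exists>H. ?P H \<and> (\<forall>H'. ?P H' \<longrightarrow> card H' \<le> card H)"
    by (rule ex_has_greatest_nat)
  then obtain p r where r: "\<And>x. linpoly p x = 0 \<Longrightarrow> h x = linpoly r x"
    and max: "\<forall>H'. ?P H' \<longrightarrow> card H' \<le> card {x. linpoly p x = 0}"
    by (elim exE conjE) blast
  have "linpoly p v = 0" for v
  proof (rule ccontr)
    assume v: "linpoly p v \<noteq> 0"
    obtain p2 where p2: "\<And>x. (linpoly p x)\<^sup>2 = linpoly p2 x" using linpoly_square by blast
    define p' where "p' = (\<lambda>i. p2 i + linpoly p v * p i)"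
    define t where "t = (h v + linpoly r v) / linpoly p v"
    define r' where "r' = (\<lambda>i. r i + t * p i)"
    have p': "linpoly p' x = linpoly p x * (linpoly p x + linpoly p v)" for x
      unfolding p'_def linpoly_combine[symmetric] p2[symmetric]
      by (simp add: power2_eq_square algebra_simps)
    have "h x = linpoly r' x" if "linpoly p' x = 0" for x
    proof (cases "linpoly p x = 0")
      case True
      then show ?thesis using r by (simp add: r'_def flip: linpoly_combine)
    next
      case False
      then have "linpoly p x = linpoly p v"
        using that unfolding p' by (metis char2(3) minus_unique mult_eq_0_iff)
      then have "linpoly p (x + v) = 0" by (simp add: linpoly_add char2)
      then have "h (x + v) = linpoly r (x + v)" by (rule r)
      then have "h x = linpoly r x + (h v + linpoly r v)"
        unfolding add linpoly_add by (metis char2(2) add.commute add.left_commute)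
      also have "h v + linpoly r v = t * linpoly p x"
        using v \<open>linpoly p x = linpoly p v\<close> by (simp add: t_def)
      finally show ?thesis by (simp add: r'_def flip: linpoly_combine)
    qed
    then have "?P {x. linpoly p' x = 0}" by blast
    then have "card {x. linpoly p' x = 0} \<le> card {x. linpoly p x = 0}" by (rule max[rule_format])
    then have "{x. linpoly p x = 0} = {x. linpoly p' x = 0}"
      using p' by (intro card_seteq) auto
    moreover have "linpoly p' v = 0" by (simp add: p' char2)
    ultimately show False using v by blast
  qed
  then show ?thesis using r by blast
qed

section \<open>Coefficients of biadditive maps\<close>

definition bipoly :: "(nat \<Rightarrow> nat \<Rightarrow> 'a) \<Rightarrow> 'a \<Rightarrow> 'a \<Rightarrow> 'a" where
  "bipoly C x u = (\<Sum>i<m. \<Sum>j<m. C i j * x ^ 2 ^ i * u ^ 2 ^ j)"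

text \<open>Uniqueness of linearized coefficients, applied in each variable in turn. Indices are
  reduced modulo \<open>m\<close> so that exponents such as \<open>3 * k\<close> can be inserted
  directly.\<close>

lemma bipoly_eqD:
  assumes eq: "\<And>x u. bipoly C x u = bipoly D x u"
  shows "C (i mod m) (j mod m) = D (i mod m) (j mod m)"
proof -
  have ij: "i mod m < m" "j mod m < m" using m_pos by simp_all
  have *: "bipoly C x u = linpoly (\<lambda>i. linpoly (C i) u) x" for C x u
    by (simp add: bipoly_def linpoly_def sum_distrib_left sum_distrib_right mult_ac)
  have diff: "linpoly a x - linpoly b x = linpoly (\<lambda>i. a i - b i) x" for a b x
    by (simp add: linpoly_def sum_subtractf algebra_simps)
  have "linpoly (\<lambda>j. C (i mod m) j - D (i mod m) j) u = 0" for u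
    using linpoly_eq_0[of "\<lambda>i. linpoly (C i) u - linpoly (D i) u", OF _ ij(1)] eq
    by (simp add: * flip: diff)
  from linpoly_eq_0[OF this ij(2)] show ?thesis by simp
qed

definition mono_coeff :: "'a \<Rightarrow> nat \<Rightarrow> nat \<Rightarrow> nat \<Rightarrow> nat \<Rightarrow> 'a" where
  "mono_coeff c s t i j = (if i = s mod m \<and> j = t mod m then c else 0)"

text \<open>The coefficients of \<open>linpoly n\<close> applied to one monomial: the term with
  index \<open>r\<close> conjugates \<open>c\<close> and moves both exponents by \<open>r\<close>,
  hence along a diagonal.\<close>

definition shift_coeff :: "(nat \<Rightarrow> 'a) \<Rightarrow> 'a \<Rightarrow> nat \<Rightarrow> nat \<Rightarrow> nat \<Rightarrow> nat \<Rightarrow> 'a" where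
  "shift_coeff n c s t i j = (\<Sum>r<m. mono_coeff (n r * c ^ 2 ^ r) (s + r) (t + r) i j)"

lemma bipoly_add: "bipoly C x u + bipoly D x u = bipoly (\<lambda>i j. C i j + D i j) x u"
  by (simp add: bipoly_def sum.distrib algebra_simps)

lemma bipoly_mult: "linpoly a x * linpoly b u = bipoly (\<lambda>i j. a i * b j) x u"
  by (simp add: bipoly_def linpoly_def sum_product mult_ac)

lemma bipoly_mono: "c * x ^ 2 ^ s * u ^ 2 ^ t = bipoly (mono_coeff c s t) x u"
proof -
  have st: "s mod m < m" "t mod m < m" using m_pos by simp_all
  have "(\<Sum>j<m. mono_coeff c s t i j * x ^ 2 ^ i * u ^ 2 ^ j) =
      (if i = s mod m then c * x ^ 2 ^ s * u ^ 2 ^ t else 0)" for i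
  proof -
    have "(\<Sum>j<m. mono_coeff c s t i j * x ^ 2 ^ i * u ^ 2 ^ j) =
        (\<Sum>j<m. if j = t mod m then if i = s mod m then c * x ^ 2 ^ s * u ^ 2 ^ t else 0 else 0)"
      by (intro sum.cong) (auto simp: mono_coeff_def frob_mod)
    then show ?thesis using st by simp
  qed
  then show ?thesis using st by (simp add: bipoly_def)
qed

lemma bipoly_shift: "linpoly n (c * (x ^ 2 ^ s * u ^ 2 ^ t)) = bipoly (shift_coeff n c s t) x u"
proof -
  have "linpoly n (c * (x ^ 2 ^ s * u ^ 2 ^ t)) =
      (\<Sum>r<m. (n r * c ^ 2 ^ r) * x ^ 2 ^ (s + r) * u ^ 2 ^ (t + r))"
    by (simp add: linpoly_def power_mult_distrib mult_ac power_add flip: power_mult)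
  also have "\<dots> = (\<Sum>r<m. bipoly (mono_coeff (n r * c ^ 2 ^ r) (s + r) (t + r)) x u)"
    by (intro sum.cong refl bipoly_mono)
  also have "\<dots> = bipoly (shift_coeff n c s t) x u"
    unfolding bipoly_def shift_coeff_def sum_distrib_right
    by (subst sum.swap, rule sum.cong[OF refl], subst sum.swap, rule refl)
  finally show ?thesis .
qed

lemma mono_coeff_eq:
  "mono_coeff c s t (i mod m) (j mod m) = (if [i = s] (mod m) \<and> [j = t] (mod m) then c else 0)"
  by (simp add: mono_coeff_def cong_def)

lemma shift_coeff_same:
  assumes "r < m"
  shows "shift_coeff n c s t ((s + r) mod m) ((t + r) mod m) = n r * c ^ 2 ^ r"
proof -
  have "(s + r) mod m = (s + r') mod m \<longleftrightarrow> r' = r" if "r' < m" for r'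
    using that assms by (metis cong_add_lcancel_nat cong_def mod_less)
  then have "shift_coeff n c s t ((s + r) mod m) ((t + r) mod m) =
      (\<Sum>r'<m. if r' = r then n r' * c ^ 2 ^ r' else 0)"
    unfolding shift_coeff_def mono_coeff_def by (intro sum.cong) auto
  then show ?thesis using assms by simp
qed

text \<open>Simultaneous shifts preserve \<open>i - j\<close> modulo \<open>m\<close>, so the
  support lies on the diagonal of \<open>s - t\<close>. The congruence is written with sums to stay
  within the natural numbers.\<close>

lemma shift_coeff_off:
  assumes "\<not> [i + t = j + s] (mod m)"
  shows "shift_coeff n c s t (i mod m) (j mod m) = 0"
proof -
  have "\<not> ([i = s + r] (mod m) \<and> [j = t + r] (mod m))" for r
  proof
    assume "[i = s + r] (mod m) \<and> [j = t + r] (mod m)"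
    then have "[i + t = (s + r) + t] (mod m)" "[j + s = (t + r) + s] (mod m)"
      by (simp_all add: cong_add_rcancel_nat)
    then have "[i + t = j + s] (mod m)"
      by (metis (no_types, lifting) add.commute add.left_commute cong_sym cong_trans)
    then show False using assms by blast
  qed
  then show ?thesis unfolding shift_coeff_def mono_coeff_eq by (intro sum.neutral) auto
qed

section \<open>The polar form of a Taniguchi function\<close>

definition taniguchi_form :: "nat \<Rightarrow> 'a \<Rightarrow> 'a \<times> 'a \<Rightarrow> 'a \<times> 'a \<Rightarrow> 'a \<times> 'a" where
  "taniguchi_form k \<beta> = (\<lambda>(x, y) (u, v).
     (x ^ 2 ^ (3 * k) * u ^ 2 ^ (2 * k) + x ^ 2 ^ (2 * k) * u ^ 2 ^ (3 * k)
        + x ^ 2 ^ (2 * k) * v ^ 2 ^ k + u ^ 2 ^ (2 * k) * y ^ 2 ^ k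
        + \<beta> * (y ^ 2 ^ k * v + y * v ^ 2 ^ k),
      x * v + y * u))"

lemma char2_prod: "p + p = (0 :: 'a \<times> 'a)"
  by (cases p) (simp add: char2 zero_prod_def)

lemmas char2_prod_simps = exponent2_simps[OF char2_prod]

lemma taniguchi_eq:
  "taniguchi k 1 \<beta> (x, y) = (x ^ 2 ^ (3 * k) * x ^ 2 ^ (2 * k) + x ^ 2 ^ (2 * k) * y ^ 2 ^ k
     + \<beta> * (y ^ 2 ^ k * y), x * (y :: 'a))"
proof -
  have "(2::nat) ^ (2 * k) * (2 ^ k + 1) = 2 ^ (3 * k) + 2 ^ (2 * k)"
    by (simp add: algebra_simps flip: power_add)
  then show ?thesis by (simp add: taniguchi_def power_add mult_ac)
qed

lemma taniguchi_0: "taniguchi k 1 (\<beta> :: 'a) 0 = 0"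
  by (simp add: zero_prod_def taniguchi_eq power_0_left)

lemma taniguchi_polar:
  "taniguchi k 1 \<beta> (p + r) = taniguchi k 1 \<beta> p + taniguchi k 1 \<beta> r + taniguchi_form k \<beta> p r"
  by (cases p; cases r) (simp add: taniguchi_eq taniguchi_form_def frob_add algebra_simps)

lemma taniguchi_form_add:
  "taniguchi_form k \<beta> (p + p') r = taniguchi_form k \<beta> p r + taniguchi_form k \<beta> p' r"
  by (cases p; cases p'; cases r) (simp add: taniguchi_form_def frob_add algebra_simps)

lemma taniguchi_form_frob:
  "taniguchi_form k (\<beta> ^ 2 ^ i) (x ^ 2 ^ i, y ^ 2 ^ i) (u ^ 2 ^ i, v ^ 2 ^ i)
     = (fst (taniguchi_form k \<beta> (x, y) (u, v)) ^ 2 ^ i, snd (taniguchi_form k \<beta> (x, y) (u, v)) ^ 2 ^ i)"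
  by (simp add: taniguchi_form_def frob_add power_mult_distrib mult.commute[of "2 ^ i" "2 ^ _"] flip: power_mult)

text \<open>As \<open>k\<close> is invertible modulo \<open>m\<close>, iterating the map
  \<open>t \<mapsto> t ^ 2 ^ k\<close> yields squaring, so \<open>t\<close> is idempotent.\<close>

lemma frob_fixed:
  fixes t :: 'a
  assumes "coprime k m" and t: "t ^ 2 ^ k = t"
  shows "t = 0 \<or> t = 1"
proof -
  obtain n where "[k * n = 1] (mod m)"
    using cong_solve_coprime_nat[OF assms(1)] by auto
  then have "t ^ 2 ^ (k * n) = t ^ 2 ^ 1"
    using frob_mod[of t "k * n"] frob_mod[of t 1] by (simp add: cong_def)
  moreover have "t ^ 2 ^ (k * n) = t"
    by (induction n) (simp_all add: power_add power_mult t)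
  ultimately have "t * t = t * 1" by (simp add: power2_eq_square)
  then show ?thesis by simp
qed

text \<open>This is the APN property. The second component forces \<open>p = t r\<close> for a
  scalar \<open>t\<close>; the first then depends on \<open>t\<close> only through
  \<open>s = t ^ 2 ^ k + t\<close>. A nonzero \<open>s\<close> would produce a root of the forbidden
  polynomial, and \<open>s = 0\<close> means \<open>t\<close> is 0 or 1.\<close>

lemma taniguchi_form_eq_0:
  assumes "coprime k m" and root: "\<And>x. x ^ (2 ^ k + 1) + x + \<beta> \<noteq> 0"
    and zero: "taniguchi_form k \<beta> p r = 0" and "r \<noteq> 0"
  shows "p = 0 \<or> p = r"
proof -
  obtain x y u v where pr: "p = (x, y)" "r = (u, v)" by (cases p; cases r)
  have "x * v + y * u = 0" using zero by (simp add: pr taniguchi_form_def zero_prod_def)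
  then have xy: "x * v = y * u" by (metis char2(3) minus_unique)
  have "\<exists>t. x = t * u \<and> y = t * v"
  proof (cases "u = 0")
    case True
    then have "v \<noteq> 0" using \<open>r \<noteq> 0\<close> pr by (simp add: zero_prod_def)
    then show ?thesis using xy True by (intro exI[of _ "y / v"]) auto
  next
    case False
    then show ?thesis using xy by (intro exI[of _ "x / u"]) (auto simp: field_simps)
  qed
  then obtain t where t: "x = t * u" "y = t * v" by blast
  define s where "s = t ^ 2 ^ k + t"
  have frob: "(z ^ 2 ^ i) ^ 2 ^ j = z ^ 2 ^ (i + j)" for z :: 'a and i j
    by (simp add: power_add flip: power_mult)
  have s1: "s ^ 2 ^ k = t ^ 2 ^ (2 * k) + t ^ 2 ^ k"
    by (simp add: s_def frob_add frob mult_2)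
  have s2: "s ^ 2 ^ (2 * k) = t ^ 2 ^ (3 * k) + t ^ 2 ^ (2 * k)"
    by (simp add: s_def frob_add frob algebra_simps)
  have eq: "s ^ 2 ^ (2 * k) * u ^ 2 ^ (3 * k) * u ^ 2 ^ (2 * k) + s ^ 2 ^ k * u ^ 2 ^ (2 * k) * v ^ 2 ^ k
      + \<beta> * s * v ^ 2 ^ k * v = 0"
    using zero unfolding s1 s2
    by (simp add: s_def pr t taniguchi_form_def zero_prod_def power_mult_distrib algebra_simps)
  have "s = 0"
  proof (rule ccontr)
    assume s: "s \<noteq> 0"
    have v: "v \<noteq> 0"
      using eq s \<open>r \<noteq> 0\<close> by (auto simp: pr zero_prod_def power_0_left)
    \<comment> \<open>Dividing \<open>eq\<close> by \<open>s * v ^ 2 ^ k * v\<close> turns its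
      second term into this \<open>X\<close> and its first into
      \<open>X ^ 2 ^ k * X\<close>.\<close>
    define X where "X = s ^ 2 ^ k * u ^ 2 ^ (2 * k) / (s * v)"
    have X: "X ^ 2 ^ k = s ^ 2 ^ (2 * k) * u ^ 2 ^ (3 * k) / (s ^ 2 ^ k * v ^ 2 ^ k)"
    proof -
      have "(s ^ 2 ^ k) ^ 2 ^ k = s ^ 2 ^ (2 * k)" "(u ^ 2 ^ (2 * k)) ^ 2 ^ k = u ^ 2 ^ (3 * k)"
        by (simp_all add: frob flip: mult_2)
      then show ?thesis by (simp add: X_def power_divide power_mult_distrib)
    qed
    have "(X ^ 2 ^ k * X + X + \<beta>) * (s * v ^ 2 ^ k * v) = 0"
      unfolding X unfolding X_def using s v eq by (simp add: field_simps)
    then have "X ^ (2 ^ k + 1) + X + \<beta> = 0" using s v by (simp add: mult.commute)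
    then show False using root by blast
  qed
  then have "t ^ 2 ^ k = t" unfolding s_def by (metis char2(3) minus_unique)
  then have "t = 0 \<or> t = 1" using frob_fixed assms(1) by blast
  then show ?thesis using t pr by (auto simp: zero_prod_def)
qed

text \<open>Nondegeneracy of the alternating form \<open>x * v + y * u\<close>, which makes the
  components of the product \<open>x * y\<close> bent.\<close>

lemma snd_taniguchi_form_surj:
  assumes "r \<noteq> 0"
  shows "\<exists>p. snd (taniguchi_form k \<beta> p r) = t"
proof (cases r)
  case (Pair u v)
  show ?thesis
  proof (cases "u = 0")
    case True
    then have "v \<noteq> 0" using assms Pair by (simp add: zero_prod_def)
    then show ?thesis using Pair by (intro exI[of _ "(t / v, 0)"]) (simp add: taniguchi_form_def True)
  next
    case False
    then show ?thesis using Pair by (intro exI[of _ "(0, t / u)"]) (simp add: taniguchi_form_def)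
  qed
qed

section \<open>From CCZ-equivalence to linear equivalence of polar forms\<close>

lemma ccz_equivalent_taniguchi_imp_linear:
  fixes \<beta> \<beta>' :: 'a
  assumes "2 \<le> m" and "coprime l m"
    and root: "\<And>x. x ^ (2 ^ l + 1) + x + \<beta>' \<noteq> 0"
    and ccz: "ccz_equivalent (taniguchi k 1 \<beta>) (taniguchi l 1 \<beta>')"
  obtains L N where "bij L" "\<And>p r. L (p + r) = L p + L r" "\<And>p r. N (p + r) = N p + N r"
    "\<And>p r. taniguchi_form l \<beta>' (L p) (L r) = N (taniguchi_form k \<beta> p r)"
proof -
  define f where "f = taniguchi k 1 \<beta>"
  define g where "g = taniguchi l 1 \<beta>'"
  obtain C \<Lambda> c where "bij C" and lin: "Vector_Spaces.linear scale2 scale2 \<Lambda>"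
    and C: "C = (\<lambda>v. \<Lambda> v + c)" and graph: "C ` fun_graph f = fun_graph g"
    using ccz unfolding ccz_equivalent_def affine_permutation2_def f_def g_def by blast
  have \<Lambda>_add: "\<Lambda> (v + w) = \<Lambda> v + \<Lambda> w" for v w
    using lin unfolding Vector_Spaces.linear_iff by blast
  have \<Lambda>_0: "\<Lambda> 0 = 0" by (rule additive_zero) (rule \<Lambda>_add)
  define A where "A v = fst (C (v, f v))" for v
  have gA: "g (A v) = snd (C (v, f v))" for v
  proof -
    have "C (v, f v) \<in> fun_graph g" 
      unfolding graph[symmetric] unfolding fun_graph_def by blast
    then obtain w where "C (v, f v) = (w, g w)" unfolding fun_graph_def by blast
    then show ?thesis by (simp add: A_def)
  qed
  have "inj A"
  proof (rule injI)
    fix v w assume "A v = A w"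
    then have "C (v, f v) = C (w, f w)" using gA by (metis A_def prod.collapse)
    then show "v = w" using \<open>bij C\<close> by (auto simp: bij_def inj_eq)
  qed
  then have "bij A" by (simp add: bij_def finite_UNIV_inj_surj)
  \<comment> \<open>\<open>T\<close> and \<open>N\<close> are the two parts of
    \<open>\<Lambda>\<close> on the second factor, where the polar form of \<open>f\<close>
    enters.\<close>
  define T where "T t = fst (\<Lambda> (0, t))" for t
  define N where "N t = snd (\<Lambda> (0, t))" for t
  have T_add: "T (s + t) = T s + T t" and N_add: "N (s + t) = N s + N t" for s t
    using \<Lambda>_add[of "(0, s)" "(0, t)"] by (simp_all add: T_def N_def)
  have C_polar: "C (u + v, f (u + v)) = C (u, f u) + C (v, f v) + C (0, f 0) + \<Lambda> (0, taniguchi_form k \<beta> u v)"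
    for u v
  proof -
    have "(u + v, f (u + v)) = (u, f u) + (v, f v) + (0, taniguchi_form k \<beta> u v)"
      by (simp add: f_def taniguchi_polar)
    then have "C (u + v, f (u + v)) = \<Lambda> (u, f u) + \<Lambda> (v, f v) + \<Lambda> (0, taniguchi_form k \<beta> u v) + c"
      by (simp only: C \<Lambda>_add)
    moreover have "f 0 = 0" by (simp add: f_def taniguchi_0)
    moreover have "c + (c + x) = x" for x :: "('a \<times> 'a) \<times> 'a \<times> 'a"
      by (rule exponent2_simps(2)) (simp add: prod_eq_iff char2)
    ultimately show ?thesis by (simp add: C \<Lambda>_0 add_ac flip: zero_prod_def)
  qed
  have A_polar: "A (u + v) = A u + A v + A 0 + T (taniguchi_form k \<beta> u v)" for u v
    by (simp add: A_def C_polar T_def)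
  have gA_polar: "g (A (u + v)) = g (A u) + g (A v) + g (A 0) + N (taniguchi_form k \<beta> u v)" for u v
    unfolding gA by (simp add: C_polar N_def)
  have g_polar: "g (p + r) = g p + g r + g 0 + taniguchi_form l \<beta>' p r" for p r
    by (simp add: g_def taniguchi_polar taniguchi_0)
  let ?H = "range (\<lambda>s. T (s, 0))"
  have H0: "0 \<in> ?H" using additive_zero[of T, OF T_add] by (metis rangeI zero_prod_def)
  have H_add: "x + y \<in> ?H" if "x \<in> ?H" "y \<in> ?H" for x y
    using that by (auto simp flip: T_add)
  have T_H: "T t \<in> ?H" for t
  proof (rule permutation_no_bent_component[OF char2_prod \<open>bij A\<close> A_polar _ H0 H_add])
    show "T (taniguchi_form k \<beta> (u + v) d) = T (taniguchi_form k \<beta> u d) + T (taniguchi_form k \<beta> v d)"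
      for u v d by (simp add: taniguchi_form_add T_add)
    fix d :: "'a \<times> 'a" assume "d \<noteq> 0"
    \<comment> \<open>With equal second components the sum has second component 0, so
      \<open>T\<close> sends it into \<open>?H\<close>.\<close>
    then obtain v where "snd (taniguchi_form k \<beta> v d) = snd t" using snd_taniguchi_form_surj by blast
    then have "taniguchi_form k \<beta> v d + t = (fst (taniguchi_form k \<beta> v d + t), 0)"
      by (simp add: prod_eq_iff char2)
    then show "\<exists>v. T (taniguchi_form k \<beta> v d) + T t \<in> ?H" by (metis T_add rangeI)
  qed
  have "T (taniguchi_form k \<beta> u v) = 0" for u v
  proof (rule quadratic_permutation_affine[OF char2_prod \<open>bij A\<close> A_polar _ g_polar _ _ gA_polar _ H0 T_H H_add])
    have "card ?H \<le> CARD('a)" by (rule card_image_le) simp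
    then show "card ?H * card ?H \<le> CARD('a \<times> 'a)" by (simp add: mult_le_mono)
    \<comment> \<open>From \<open>2 \<le> m\<close> there are at least 16 vectors, above the bound 8
      required for the affinity criterion.\<close>
    have "(2::nat) ^ 4 \<le> 2 ^ (m + m)" using \<open>2 \<le> m\<close> by (intro power_increasing) auto
    then show "8 < CARD('a \<times> 'a)" by (simp add: card power_add)
    show "x = 0 \<or> x = e" if "taniguchi_form l \<beta>' x e = 0" "e \<noteq> 0" for x e
      using taniguchi_form_eq_0[OF \<open>coprime l m\<close> root] that by blast
  qed (simp_all add: taniguchi_form_add T_add N_add)
  then have A_add: "A (u + v) = A u + A v + A 0" for u v using A_polar by simp
  define L where "L v = A v + A 0" for v
  have A: "A v = L v + A 0" for v by (simp add: L_def add.assoc char2_prod)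
  show ?thesis
  proof
    have "inj L" using \<open>inj A\<close> by (simp add: inj_def L_def)
    then show "bij L" by (simp add: bij_def finite_UNIV_inj_surj)
    show L_add: "L (p + r) = L p + L r" for p r
      by (simp add: L_def A_add char2_prod_simps add_ac)
    show "N (p + r) = N p + N r" for p r by (rule N_add)
    show "taniguchi_form l \<beta>' (L p) (L r) = N (taniguchi_form k \<beta> p r)" for p r
    proof -
      \<comment> \<open>Expanding both sides by the polar form of \<open>g\<close>, all terms
        involving the translation \<open>A 0\<close> cancel.\<close>
      have "g (L p + L r + A 0) = g (L p + A 0) + g (L r + A 0) + g (A 0) + N (taniguchi_form k \<beta> p r)"
        using gA_polar[of p r] by (simp add: A[of p] A[of r] A[of "p + r"] L_add)
      then have "g (L p) + (g (L r) + (taniguchi_form l \<beta>' (L p) (L r)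
          + (taniguchi_form l \<beta>' (L p) (A 0) + (taniguchi_form l \<beta>' (L r) (A 0) + g (A 0)))))
        = g (L p) + (g (L r) + (N (taniguchi_form k \<beta> p r)
          + (taniguchi_form l \<beta>' (L p) (A 0) + (taniguchi_form l \<beta>' (L r) (A 0) + g (A 0)))))"
        unfolding g_polar[of "L p + L r"] g_polar[of "L p" "L r"] g_polar[of "L p" "A 0"]
          g_polar[of "L r" "A 0"] taniguchi_form_add
        by (simp add: char2_prod_simps add_ac)
      then show ?thesis by simp
    qed
  qed
qed

section \<open>Linear equivalences of polar forms\<close>

text \<open>Cramer's rule in characteristic two: the column \<open>(a, c)\<close> is parallel to two
  independent columns \<open>(b, d)\<close> and \<open>(b', d')\<close>.\<close>

lemma cross_zero:
  fixes a b :: 'a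
  assumes "a * d + c * b = 0" "a * d' + c * b' = 0" "b * d' + d * b' \<noteq> 0"
  shows "a = 0" "c = 0"
proof -
  have "a * (b * d' + d * b') = b * (a * d' + c * b') + b' * (a * d + c * b)"
    by (simp add: algebra_simps char2)
  then show "a = 0" using assms by simp
  have "c * (b * d' + d * b') = d * (a * d' + c * b') + d' * (a * d + c * b)"
    by (simp add: algebra_simps char2)
  then show "c = 0" using assms by simp
qed

text \<open>The columns \<open>(a i, c i)\<close> and \<open>(b j, d j)\<close> of coefficients of \<open>L\<close> have determinants that are
  supported on few pairs \<open>(i, j)\<close>. A nonzero coefficient \<open>n r\<close> of the map \<open>z \<mapsto> snd (N (z, 0))\<close>
  would make column \<open>r + 3 k\<close> of the first kind parallel to the independent columns \<open>r + k\<close> and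
  \<open>r\<close> of the second kind.\<close>
lemma taniguchi_linear_equivalence_monomial:
  fixes \<beta> :: 'a
  assumes "3 < m" "0 < k" "2 * k < m" "coprime k m" "\<beta> \<noteq> 0"
    and "bij L" and L_add: "\<And>p r. L (p + r) = L p + L r" and N_add: "\<And>p r. N (p + r) = N p + N r"
    and eq: "\<And>p r. taniguchi_form l \<beta>' (L p) (L r) = N (taniguchi_form k \<beta> p r)"
  obtains i a b c d where "i < m" "a * d + b * c \<noteq> 0"
    "\<And>x y. L (x, y) = (a * x ^ 2 ^ i + b * y ^ 2 ^ i, c * x ^ 2 ^ i + d * y ^ 2 ^ i)"
proof -
  have L1: "L (x + y, 0) = L (x, 0) + L (y, 0)" "L (0, x + y) = L (0, x) + L (0, y)" for x y
    using L_add[of "(x, 0)" "(y, 0)"] L_add[of "(0, x)" "(0, y)"] by simp_all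
  have N1: "N (x + y, 0) = N (x, 0) + N (y, 0)" "N (0, x + y) = N (0, x) + N (0, y)" for x y
    using N_add[of "(x, 0)" "(y, 0)"] N_add[of "(0, x)" "(0, y)"] by simp_all
  obtain a where a: "\<And>x. fst (L (x, 0)) = linpoly a x"
    using additive_imp_linpoly[of "\<lambda>x. fst (L (x, 0))"] by (auto simp: L1)
  obtain b where b: "\<And>x. fst (L (0, x)) = linpoly b x"
    using additive_imp_linpoly[of "\<lambda>x. fst (L (0, x))"] by (auto simp: L1)
  obtain c where c: "\<And>x. snd (L (x, 0)) = linpoly c x"
    using additive_imp_linpoly[of "\<lambda>x. snd (L (x, 0))"] by (auto simp: L1)
  obtain d where d: "\<And>x. snd (L (0, x)) = linpoly d x"
    using additive_imp_linpoly[of "\<lambda>x. snd (L (0, x))"] by (auto simp: L1)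
  obtain n where n: "\<And>x. snd (N (x, 0)) = linpoly n x"
    using additive_imp_linpoly[of "\<lambda>x. snd (N (x, 0))"] by (auto simp: N1)
  obtain r where r: "\<And>x. snd (N (0, x)) = linpoly r x"
    using additive_imp_linpoly[of "\<lambda>x. snd (N (0, x))"] by (auto simp: N1)
  have L: "L (x, y) = (linpoly a x + linpoly b y, linpoly c x + linpoly d y)" for x y
    using L_add[of "(x, 0)" "(0, y)"] by (simp add: prod_eq_iff a b c d)
  have N: "snd (N (x, y)) = linpoly n x + linpoly r y" for x y
    using N_add[of "(x, 0)" "(0, y)"] by (simp add: n r)
  have lin0: "linpoly h 0 = 0" for h by (simp add: linpoly_def power_0_left)
  have snd_form: "snd (taniguchi_form l \<beta>' (X, Y) (U, V)) = X * V + Y * U" for X Y U V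
    by (simp add: taniguchi_form_def)
  have snd_eq: "(linpoly a x + linpoly b y) * (linpoly c u + linpoly d v)
      + (linpoly c x + linpoly d y) * (linpoly a u + linpoly b v) = snd (N (taniguchi_form k \<beta> (x, y) (u, v)))"
    for x y u v
    using arg_cong[OF eq[of "(x, y)" "(u, v)"], of snd] by (simp only: L snd_form)
  \<comment> \<open>Coefficients are compared on three slices: \<open>y = v = 0\<close> here, then
    \<open>y = u = 0\<close> and \<open>x = u = 0\<close>.\<close>
  have xu: "a (I mod m) * c (J mod m) + c (I mod m) * a (J mod m)
      = shift_coeff n 1 (3 * k) (2 * k) (I mod m) (J mod m)
        + shift_coeff n 1 (2 * k) (3 * k) (I mod m) (J mod m)" for I J
  proof (rule bipoly_eqD)
    fix x u
    have "linpoly a x * linpoly c u + linpoly c x * linpoly a u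
        = linpoly n (1 * (x ^ 2 ^ (3 * k) * u ^ 2 ^ (2 * k))) + linpoly n (1 * (x ^ 2 ^ (2 * k) * u ^ 2 ^ (3 * k)))"
      using snd_eq[of x 0 u 0] by (simp add: taniguchi_form_def N lin0 linpoly_add power_0_left)
    then show "bipoly (\<lambda>i j. a i * c j + c i * a j) x u
        = bipoly (\<lambda>i j. shift_coeff n 1 (3 * k) (2 * k) i j + shift_coeff n 1 (2 * k) (3 * k) i j) x u"
      by (simp only: bipoly_mult bipoly_shift bipoly_add)
  qed
  have xv: "a (I mod m) * d (J mod m) + c (I mod m) * b (J mod m)
      = shift_coeff n 1 (2 * k) k (I mod m) (J mod m) + shift_coeff r 1 0 0 (I mod m) (J mod m)" for I J
  proof (rule bipoly_eqD)
    fix x v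
    have "linpoly a x * linpoly d v + linpoly c x * linpoly b v
        = linpoly n (1 * (x ^ 2 ^ (2 * k) * v ^ 2 ^ k)) + linpoly r (1 * (x ^ 2 ^ 0 * v ^ 2 ^ 0))"
      using snd_eq[of x 0 0 v] by (simp add: taniguchi_form_def N lin0 power_0_left)
    then show "bipoly (\<lambda>i j. a i * d j + c i * b j) x v
        = bipoly (\<lambda>i j. shift_coeff n 1 (2 * k) k i j + shift_coeff r 1 0 0 i j) x v"
      by (simp only: bipoly_mult bipoly_shift bipoly_add)
  qed
  have yv: "b (I mod m) * d (J mod m) + d (I mod m) * b (J mod m)
      = shift_coeff n \<beta> k 0 (I mod m) (J mod m) + shift_coeff n \<beta> 0 k (I mod m) (J mod m)" for I J
  proof (rule bipoly_eqD)
    fix y v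
    have "linpoly b y * linpoly d v + linpoly d y * linpoly b v
        = linpoly n (\<beta> * (y ^ 2 ^ k * v ^ 2 ^ 0)) + linpoly n (\<beta> * (y ^ 2 ^ 0 * v ^ 2 ^ k))"
      using snd_eq[of 0 y 0 v]
      by (simp add: taniguchi_form_def N lin0 power_0_left distrib_left linpoly_add)
    then show "bipoly (\<lambda>i j. b i * d j + d i * b j) y v
        = bipoly (\<lambda>i j. shift_coeff n \<beta> k 0 i j + shift_coeff n \<beta> 0 k i j) y v"
      by (simp only: bipoly_mult bipoly_shift bipoly_add)
  qed
  have n0: "n s = 0" if s: "s < m" for s
  proof (rule ccontr)
    assume ns: "n s \<noteq> 0"
    have k1: "\<not> [i = j] (mod m)" if "i = j + k \<or> j = i + k" for i j
      using that assms by (intro not_cong_add[of k]) auto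
    have k2: "\<not> [i = j] (mod m)" if "i = j + 2 * k \<or> j = i + 2 * k" for i j
      using that assms by (intro not_cong_add[of "2 * k"]) auto
    \<comment> \<open>Here \<open>3 < m\<close> enters: since \<open>k\<close> is coprime to
      \<open>m\<close>, a wrap-around of \<open>3 * k\<close> would make \<open>m\<close> divide
      3.\<close>
    have k3: "\<not> [i = j + 3 * k] (mod m)" if "i = j" for i j
    proof
      assume "[i = j + 3 * k] (mod m)"
      then have "m dvd 3 * k" using that by (simp add: cong_add_lcancel_0_nat cong_sym_eq[of j] cong_0_iff)
      then have "m dvd 3" using \<open>coprime k m\<close> by (simp add: coprime_commute coprime_dvd_mult_left_iff)
      then show False using \<open>3 < m\<close> by (auto dest: dvd_imp_le)
    qed
    let ?p = "3 * k + s"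
    have "a (?p mod m) * c ((2 * k + s) mod m) + c (?p mod m) * a ((2 * k + s) mod m) = n s"
      unfolding xu shift_coeff_same[OF s]
      by (subst shift_coeff_off) (auto intro!: k2)
    then have nz: "a (?p mod m) \<noteq> 0 \<or> c (?p mod m) \<noteq> 0" using ns by auto
    have 1: "a (?p mod m) * d ((k + s) mod m) + c (?p mod m) * b ((k + s) mod m) = 0"
      unfolding xv by (subst (1 2) shift_coeff_off) (simp_all add: k1 k2)
    have 2: "a (?p mod m) * d ((0 + s) mod m) + c (?p mod m) * b ((0 + s) mod m) = 0"
      unfolding xv
    proof (subst (1 2) shift_coeff_off)
      show "\<not> [3 * k + s + 0 = 0 + s + 0] (mod m)"
        using k3[of "s" "s"] by (simp add: cong_sym_eq add.commute)
    qed (auto intro!: k2)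
    have "b ((k + s) mod m) * d ((0 + s) mod m) + d ((k + s) mod m) * b ((0 + s) mod m) = n s * \<beta> ^ 2 ^ s"
      unfolding yv shift_coeff_same[OF s]
      by (subst shift_coeff_off) (auto intro!: k2)
    then have "b ((k + s) mod m) * d ((0 + s) mod m) + d ((k + s) mod m) * b ((0 + s) mod m) \<noteq> 0"
      using ns \<open>\<beta> \<noteq> 0\<close> by simp
    from cross_zero[OF 1 2 this] nz show False by blast
  qed
  then have shift0: "shift_coeff n z s t i j = 0" for z s t i j
    by (auto simp: shift_coeff_def mono_coeff_def intro!: sum.neutral)
  have ac: "a i * c j + c i * a j = 0" and bd: "b i * d j + d i * b j = 0"
    if "i < m" "j < m" for i j
    using xu[of i j] yv[of i j] that by (simp_all add: shift0)
  have adcb: "a i * d j + c i * b j = 0" if "i < m" "j < m" "i \<noteq> j" for i j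
    using xv[of i j] shift_coeff_off[of i 0 j 0 r 1] that by (simp add: shift0 cong_def)
  have "\<exists>i<m. a i * d i + c i * b i \<noteq> 0"
  proof (rule ccontr)
    assume "\<not> ?thesis"
    then have all: "a i * d j + c i * b j = 0" if "i < m" "j < m" for i j
      using adcb that by metis
    \<comment> \<open>If all mixed determinants vanish, every column is parallel to any nonzero one.
      A vector \<open>(p, q)\<close> built from such a column annihilates the whole image of
      \<open>L\<close>, against surjectivity.\<close>
    have "\<exists>p q. (p \<noteq> 0 \<or> q \<noteq> 0) \<and> (\<forall>j<m. p * c j + q * a j = 0 \<and> p * d j + q * b j = 0)"
    proof (cases "\<exists>i<m. a i \<noteq> 0 \<or> c i \<noteq> 0")
      case True
      then show ?thesis using ac all by blast
    next
      case False
      show ?thesis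
      proof (cases "\<exists>i<m. b i \<noteq> 0 \<or> d i \<noteq> 0")
        case True
        then show ?thesis using bd False by (metis add.right_neutral mult_zero_right)
      next
        case False' : False
        then show ?thesis using False by (intro exI[of _ 1]) simp
      qed
    qed
    then obtain p q where pq: "p \<noteq> 0 \<or> q \<noteq> 0"
      and "\<And>j. j < m \<Longrightarrow> p * c j + q * a j = 0" "\<And>j. j < m \<Longrightarrow> p * d j + q * b j = 0"
      by blast
    then have lp: "p * linpoly c x + q * linpoly a x = 0" "p * linpoly d x + q * linpoly b x = 0" for x
      by (simp_all add: linpoly_def sum_distrib_left flip: sum.distrib mult.assoc distrib_right)
    have vanish: "p * snd (L v) + q * fst (L v) = 0" for v
    proof (cases v)
      case (Pair x y)
      have "p * snd (L v) + q * fst (L v)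
          = (p * linpoly c x + q * linpoly a x) + (p * linpoly d y + q * linpoly b y)"
        by (simp add: Pair L algebra_simps)
      then show ?thesis by (simp add: lp)
    qed
    obtain v w where "L v = (1, 0)" "L w = (0, 1)" using \<open>bij L\<close> by (metis bij_pointE)
    then show False using vanish[of v] vanish[of w] pq by simp
  qed
  then obtain i where i: "i < m" and det: "a i * d i + c i * b i \<noteq> 0" by blast
  \<comment> \<open>Any column with index \<open>j \<noteq> i\<close> is parallel to both columns of
    index \<open>i\<close>, which are independent.\<close>
  have others: "a j = 0 \<and> c j = 0 \<and> b j = 0 \<and> d j = 0" if "j < m" "j \<noteq> i" for j
  proof -
    have "a j * c i + c j * a i = 0" "a j * d i + c j * b i = 0" "b j * d i + d j * b i = 0"
      "b j * c i + d j * a i = 0"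
      using ac[of j i] bd[of j i] adcb[of j i] adcb[of i j] that i by (auto simp: mult.commute add.commute)
    then show ?thesis
      using cross_zero[of "a j" "c i" "c j" "a i" "d i" "b i"]
        cross_zero[of "b j" "c i" "d j" "a i" "d i" "b i"] det by (simp add: mult.commute)
  qed
  have single: "linpoly h x = h i * x ^ 2 ^ i" if "\<And>j. j < m \<Longrightarrow> j \<noteq> i \<Longrightarrow> h j = 0" for h x
  proof -
    have "linpoly h x = (\<Sum>j<m. if j = i then h j * x ^ 2 ^ j else 0)"
      unfolding linpoly_def using that by (intro sum.cong) auto
    then show ?thesis using i by simp
  qed
  show ?thesis
  proof (rule that[OF i])
    show "a i * d i + b i * c i \<noteq> 0" using det by (simp add: mult.commute)
    show "L (x, y) = (a i * x ^ 2 ^ i + b i * y ^ 2 ^ i, c i * x ^ 2 ^ i + d i * y ^ 2 ^ i)" for x y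
      using others by (simp add: L single)
  qed
qed

text \<open>Each monomial on the right lies on a diagonal with difference \<open>0\<close>,
  \<open>k\<close> or \<open>-k\<close>. Entries on the left off these diagonals force the matrix to
  be diagonal, then \<open>k = l\<close>; the remaining coefficients are all governed by
  \<open>n 0\<close>.\<close>

lemma taniguchi_matrix_equivalence:
  fixes a b c d \<beta> \<beta>' :: 'a
  assumes "0 < k" "2 * k < m" "0 < l" "2 * l < m" "\<beta>' \<noteq> 0" and det: "a * d + b * c \<noteq> 0"
    and add1: "\<And>x y. N1 (x + y) = N1 x + N1 y" and add2: "\<And>x y. N2 (x + y) = N2 x + N2 y"
    and eq: "\<And>x y u v. fst (taniguchi_form l \<beta>' (a * x + b * y, c * x + d * y) (a * u + b * v, c * u + d * v))
      = N1 (fst (taniguchi_form k \<beta> (x, y) (u, v))) + N2 (x * v + y * u)"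
  shows "k = l \<and> \<beta>' = \<beta>"
proof -
  obtain n where n: "\<And>x. N1 x = linpoly n x" using additive_imp_linpoly[of N1, OF add1] by blast
  obtain r where r: "\<And>x. N2 x = linpoly r x" using additive_imp_linpoly[of N2, OF add2] by blast
  have lin0: "linpoly h 0 = 0" for h by (simp add: linpoly_def power_0_left)
  note form = taniguchi_form_def n r lin0 power_0_left power_mult_distrib
  have l1: "\<not> [i = j] (mod m)" if "i = j + l \<or> j = i + l" for i j
    using that assms by (intro not_cong_add[of l]) auto
  have l2: "\<not> [i = j] (mod m)" if "i = j + 2 * l \<or> j = i + 2 * l" for i j
    using that assms by (intro not_cong_add[of "2 * l"]) auto
  have kl: "\<not> [i = j] (mod m)" if "i = j + (k + l) \<or> j = i + (k + l)" for i j
    using that assms by (intro not_cong_add[of "k + l"]) auto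
  have ncong: "\<not> [l = 0] (mod m)" "\<not> [0 = l] (mod m)" "\<not> [2 * l = 0] (mod m)" "\<not> [0 = 2 * l] (mod m)"
    "\<not> [l = 2 * l] (mod m)" "\<not> [2 * l = l] (mod m)" "\<not> [3 * l = l] (mod m)" "\<not> [l = 3 * l] (mod m)"
    "\<not> [3 * l = 2 * l] (mod m)" "\<not> [2 * l = 3 * l] (mod m)"
    by (simp_all add: l1 l2)
  have xv: "mono_coeff (a ^ 2 ^ (3 * l) * b ^ 2 ^ (2 * l)) (3 * l) (2 * l) (I mod m) (J mod m)
      + mono_coeff (a ^ 2 ^ (2 * l) * b ^ 2 ^ (3 * l)) (2 * l) (3 * l) (I mod m) (J mod m)
      + mono_coeff (a ^ 2 ^ (2 * l) * d ^ 2 ^ l) (2 * l) l (I mod m) (J mod m)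
      + mono_coeff (b ^ 2 ^ (2 * l) * c ^ 2 ^ l) l (2 * l) (I mod m) (J mod m)
      + mono_coeff (\<beta>' * c ^ 2 ^ l * d) l 0 (I mod m) (J mod m)
      + mono_coeff (\<beta>' * c * d ^ 2 ^ l) 0 l (I mod m) (J mod m)
      = shift_coeff n 1 (2 * k) k (I mod m) (J mod m) + shift_coeff r 1 0 0 (I mod m) (J mod m)" for I J
  proof (rule bipoly_eqD)
    fix x v
    have "(a ^ 2 ^ (3 * l) * b ^ 2 ^ (2 * l)) * x ^ 2 ^ (3 * l) * v ^ 2 ^ (2 * l)
        + (a ^ 2 ^ (2 * l) * b ^ 2 ^ (3 * l)) * x ^ 2 ^ (2 * l) * v ^ 2 ^ (3 * l)
        + (a ^ 2 ^ (2 * l) * d ^ 2 ^ l) * x ^ 2 ^ (2 * l) * v ^ 2 ^ l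
        + (b ^ 2 ^ (2 * l) * c ^ 2 ^ l) * x ^ 2 ^ l * v ^ 2 ^ (2 * l)
        + (\<beta>' * c ^ 2 ^ l * d) * x ^ 2 ^ l * v ^ 2 ^ 0
        + (\<beta>' * c * d ^ 2 ^ l) * x ^ 2 ^ 0 * v ^ 2 ^ l
        = linpoly n (1 * (x ^ 2 ^ (2 * k) * v ^ 2 ^ k)) + linpoly r (1 * (x ^ 2 ^ 0 * v ^ 2 ^ 0))"
      using eq[of x 0 0 v] by (simp add: form algebra_simps)
    then show "bipoly (\<lambda>i j. mono_coeff (a ^ 2 ^ (3 * l) * b ^ 2 ^ (2 * l)) (3 * l) (2 * l) i j
        + mono_coeff (a ^ 2 ^ (2 * l) * b ^ 2 ^ (3 * l)) (2 * l) (3 * l) i j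
        + mono_coeff (a ^ 2 ^ (2 * l) * d ^ 2 ^ l) (2 * l) l i j
        + mono_coeff (b ^ 2 ^ (2 * l) * c ^ 2 ^ l) l (2 * l) i j
        + mono_coeff (\<beta>' * c ^ 2 ^ l * d) l 0 i j
        + mono_coeff (\<beta>' * c * d ^ 2 ^ l) 0 l i j) x v
      = bipoly (\<lambda>i j. shift_coeff n 1 (2 * k) k i j + shift_coeff r 1 0 0 i j) x v"
      by (simp only: bipoly_mono[of _ x _ v] bipoly_shift bipoly_add)
  qed
  \<comment> \<open>Difference \<open>-l\<close> is neither \<open>0\<close> nor \<open>k\<close>
    modulo \<open>m\<close>, because both \<open>l\<close> and \<open>k + l\<close> lie strictly
    between 0 and \<open>m\<close>.\<close>
  have off: "shift_coeff n 1 (2 * k) k (i mod m) (j mod m) + shift_coeff r 1 0 0 (i mod m) (j mod m) = 0"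
    if "j = i + l" for i j
    using that by (subst (1 2) shift_coeff_off) (simp_all add: l1 kl)
  have "a * b = 0"
    using xv[of "2 * l" "3 * l"] off[of "3 * l" "2 * l"] by (simp add: mono_coeff_eq ncong)
  moreover have "b * c = 0"
    using xv[of l "2 * l"] off[of "2 * l" l] by (simp add: mono_coeff_eq ncong)
  moreover have "c * d = 0"
    using xv[of 0 l, unfolded mono_coeff_eq] off[of l 0] \<open>\<beta>' \<noteq> 0\<close> by (simp add: ncong)
  ultimately have b: "b = 0" and c: "c = 0" and a: "a \<noteq> 0" and d: "d \<noteq> 0" using det by auto
  have ad: "a ^ 2 ^ (2 * l) * d ^ 2 ^ l = shift_coeff n 1 (2 * k) k ((2 * l) mod m) (l mod m)"
    using xv[of "2 * l" l] shift_coeff_off[of "2 * l" 0 l 0 r 1]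
    by (simp add: mono_coeff_eq ncong b c power_0_left)
  have xu: "mono_coeff (a ^ 2 ^ (3 * l) * a ^ 2 ^ (2 * l)) (3 * l) (2 * l) (I mod m) (J mod m)
      + mono_coeff (a ^ 2 ^ (3 * l) * a ^ 2 ^ (2 * l)) (2 * l) (3 * l) (I mod m) (J mod m)
      = shift_coeff n 1 (3 * k) (2 * k) (I mod m) (J mod m)
        + shift_coeff n 1 (2 * k) (3 * k) (I mod m) (J mod m)" for I J
  proof (rule bipoly_eqD)
    fix x u
    have "(a ^ 2 ^ (3 * l) * a ^ 2 ^ (2 * l)) * x ^ 2 ^ (3 * l) * u ^ 2 ^ (2 * l)
        + (a ^ 2 ^ (3 * l) * a ^ 2 ^ (2 * l)) * x ^ 2 ^ (2 * l) * u ^ 2 ^ (3 * l)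
        = linpoly n (1 * (x ^ 2 ^ (3 * k) * u ^ 2 ^ (2 * k))) + linpoly n (1 * (x ^ 2 ^ (2 * k) * u ^ 2 ^ (3 * k)))"
      using eq[of x 0 u 0] by (simp add: form b c linpoly_add mult_ac)
    then show "bipoly (\<lambda>i j. mono_coeff (a ^ 2 ^ (3 * l) * a ^ 2 ^ (2 * l)) (3 * l) (2 * l) i j
        + mono_coeff (a ^ 2 ^ (3 * l) * a ^ 2 ^ (2 * l)) (2 * l) (3 * l) i j) x u
      = bipoly (\<lambda>i j. shift_coeff n 1 (3 * k) (2 * k) i j + shift_coeff n 1 (2 * k) (3 * k) i j) x u"
      by (simp only: bipoly_mono[of _ x _ u] bipoly_shift bipoly_add)
  qed
  have "shift_coeff n 1 (2 * k) (3 * k) ((3 * l) mod m) ((2 * l) mod m) = 0"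
    by (rule shift_coeff_off) (auto intro!: kl)
  then have aa: "a ^ 2 ^ (3 * l) * a ^ 2 ^ (2 * l) = shift_coeff n 1 (3 * k) (2 * k) ((3 * l) mod m) ((2 * l) mod m)"
    using xu[of "3 * l" "2 * l"] by (simp add: mono_coeff_eq ncong)
  have "k = l"
  proof (rule ccontr)
    assume "k \<noteq> l"
    then have "\<not> [3 * l + 2 * k = 2 * l + 3 * k] (mod m)"
      by (intro not_cong_add[of "if k < l then l - k else k - l"]) (use assms in auto)
    then show False using aa a by (simp add: shift_coeff_off)
  qed
  \<comment> \<open>At unshifted positions only the term \<open>r = 0\<close> contributes.\<close>
  have "shift_coeff n 1 (s * l) (t * l) ((s * l) mod m) ((t * l) mod m) = n 0" for s t
    using shift_coeff_same[OF m_pos, of n 1 "s * l" "t * l"] by simp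
  from this[of 3 2] this[of 2 1] aa ad \<open>k = l\<close>
  have n0: "n 0 = a ^ 2 ^ (3 * l) * a ^ 2 ^ (2 * l)" and n0': "n 0 = a ^ 2 ^ (2 * l) * d ^ 2 ^ l"
    by simp_all
  moreover have "(a ^ 2 ^ (2 * l)) ^ 2 ^ l = a ^ 2 ^ (3 * l)"
    by (simp flip: power_mult power_add)
  ultimately have "d ^ 2 ^ l = (a ^ 2 ^ (2 * l)) ^ 2 ^ l" using a by simp
  then have da: "d = a ^ 2 ^ (2 * l)" by (simp add: frob_inj)
  have yv: "mono_coeff (\<beta>' * d ^ 2 ^ l * d) l 0 (I mod m) (J mod m)
      + mono_coeff (\<beta>' * d ^ 2 ^ l * d) 0 l (I mod m) (J mod m)
      = shift_coeff n \<beta> k 0 (I mod m) (J mod m) + shift_coeff n \<beta> 0 k (I mod m) (J mod m)" for I J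
  proof (rule bipoly_eqD)
    fix y v
    have "(\<beta>' * d ^ 2 ^ l * d) * y ^ 2 ^ l * v ^ 2 ^ 0 + (\<beta>' * d ^ 2 ^ l * d) * y ^ 2 ^ 0 * v ^ 2 ^ l
        = linpoly n (\<beta> * (y ^ 2 ^ k * v ^ 2 ^ 0)) + linpoly n (\<beta> * (y ^ 2 ^ 0 * v ^ 2 ^ k))"
      using eq[of 0 y 0 v] by (simp add: form b c distrib_left linpoly_add mult_ac)
    then show "bipoly (\<lambda>i j. mono_coeff (\<beta>' * d ^ 2 ^ l * d) l 0 i j
        + mono_coeff (\<beta>' * d ^ 2 ^ l * d) 0 l i j) y v
      = bipoly (\<lambda>i j. shift_coeff n \<beta> k 0 i j + shift_coeff n \<beta> 0 k i j) y v"
      by (simp only: bipoly_mono[of _ y _ v] bipoly_shift bipoly_add)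
  qed
  \<comment> \<open>The coefficient at \<open>(l, 0)\<close>; the second shifted monomial is on the
    diagonal \<open>-l\<close>, distinct from \<open>l\<close> as \<open>2 * l < m\<close>.\<close>
  have "\<beta>' * d ^ 2 ^ l * d = n 0 * \<beta>"
    using yv[of l 0, unfolded mono_coeff_eq] shift_coeff_off[of l l 0 0 n \<beta>] shift_coeff_same[OF m_pos, of n \<beta> l 0]
      l2[of "l + l" 0] by (simp add: ncong \<open>k = l\<close>)
  also have "\<dots> = d ^ 2 ^ l * d * \<beta>" unfolding n0' da by (simp add: mult_ac)
  finally have "(d ^ 2 ^ l * d) * \<beta>' = (d ^ 2 ^ l * d) * \<beta>" by (simp add: mult_ac)
  then have "\<beta>' = \<beta>" using d by simp
  then show ?thesis using \<open>k = l\<close> by blast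
qed

lemma taniguchi_linear_equivalence:
  fixes \<beta> \<beta>' :: 'a
  assumes "3 < m" "0 < k" "2 * k < m" "coprime k m" "\<beta> \<noteq> 0" "0 < l" "2 * l < m" "\<beta>' \<noteq> 0"
    and "bij L" and L_add: "\<And>p r. L (p + r) = L p + L r" and N_add: "\<And>p r. N (p + r) = N p + N r"
    and eq: "\<And>p r. taniguchi_form l \<beta>' (L p) (L r) = N (taniguchi_form k \<beta> p r)"
  shows "k = l \<and> (\<exists>i<m. \<beta>' = \<beta> ^ 2 ^ i)"
proof -
  obtain i a b c d where i: "i < m" and det: "a * d + b * c \<noteq> 0"
    and L: "\<And>x y. L (x, y) = (a * x ^ 2 ^ i + b * y ^ 2 ^ i, c * x ^ 2 ^ i + d * y ^ 2 ^ i)"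
    by (rule taniguchi_linear_equivalence_monomial[OF assms(1-5,9-12)]) (rule that)
  \<comment> \<open>The inverse of \<open>z \<mapsto> z ^ 2 ^ i\<close>. Substituting it turns
    \<open>L\<close> into a plain matrix and \<open>\<beta>\<close> into
    \<open>\<beta> ^ 2 ^ i\<close>.\<close>
  let ?\<tau> = "\<lambda>z::'a. z ^ 2 ^ (m - i)"
  have \<tau>: "?\<tau> z ^ 2 ^ i = z" "?\<tau> (z ^ 2 ^ i) = z" for z
    using frob_mod[of z m] i by (simp_all flip: power_mult power_add)
  have "k = l \<and> \<beta>' = \<beta> ^ 2 ^ i"
  proof (rule taniguchi_matrix_equivalence[OF assms(2,3,6,7,8) det])
    fix x y u v :: 'a
    have \<tau>form: "taniguchi_form k \<beta> (?\<tau> x, ?\<tau> y) (?\<tau> u, ?\<tau> v)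
        = (?\<tau> (fst (taniguchi_form k (\<beta> ^ 2 ^ i) (x, y) (u, v))), ?\<tau> (x * v + y * u))"
      using taniguchi_form_frob[of k "\<beta> ^ 2 ^ i" "m - i" x y u v]
      by (simp add: \<tau>) (simp add: taniguchi_form_def)
    have split: "fst (N (s, t)) = fst (N (s, 0)) + fst (N (0, t))" for s t
      using N_add[of "(s, 0)" "(0, t)"] by simp
    have "fst (taniguchi_form l \<beta>' (L (?\<tau> x, ?\<tau> y)) (L (?\<tau> u, ?\<tau> v)))
        = fst (N (?\<tau> (fst (taniguchi_form k (\<beta> ^ 2 ^ i) (x, y) (u, v))), 0)) + fst (N (0, ?\<tau> (x * v + y * u)))"
      unfolding eq \<tau>form by (rule split)
    then show "fst (taniguchi_form l \<beta>' (a * x + b * y, c * x + d * y) (a * u + b * v, c * u + d * v))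
      = (\<lambda>z. fst (N (?\<tau> z, 0))) (fst (taniguchi_form k (\<beta> ^ 2 ^ i) (x, y) (u, v)))
        + (\<lambda>z. fst (N (0, ?\<tau> z))) (x * v + y * u)"
      unfolding L \<tau> .
  next
    show "fst (N (?\<tau> (x + y), 0)) = fst (N (?\<tau> x, 0)) + fst (N (?\<tau> y, 0))" for x y
      using N_add[of "(?\<tau> x, 0)" "(?\<tau> y, 0)"] by (simp add: frob_add)
    show "fst (N (0, ?\<tau> (x + y))) = fst (N (0, ?\<tau> x)) + fst (N (0, ?\<tau> y))" for x y
      using N_add[of "(0, ?\<tau> x)" "(0, ?\<tau> y)"] by (simp add: frob_add)
  qed
  then show ?thesis using i by blast
qed

section \<open>The field with eight elements\<close>

text \<open>Elements other than 0 and 1 are roots of \<open>x ^ 3 + x + 1\<close> or of its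
  reciprocal. For \<open>\<beta> = 1\<close> an element or its inverse is a root of the forbidden
  polynomial; if \<open>\<beta>\<close> is a root of the reciprocal cubic, then
  \<open>\<beta>\<^sup>2\<close> is one.\<close>

lemma no_root_F8:
  fixes \<beta> :: 'a
  assumes "m = 3" "\<beta> \<noteq> 0" and root: "\<And>x. x ^ 3 + x + \<beta> \<noteq> 0"
  shows "\<beta> ^ 3 + \<beta> + 1 = 0"
proof -
  have dichotomy: "x ^ 3 + x + 1 = 0 \<or> x ^ 3 + x\<^sup>2 + 1 = 0" if "x \<noteq> 0" "x \<noteq> 1" for x :: 'a
  proof -
    have "x * (x + 1) * (x ^ 3 + x + 1) * (x ^ 3 + x\<^sup>2 + 1) = x ^ 8 + x"
      by (simp add: algebra_simps eval_nat_numeral char2)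
    also have "\<dots> = 0" using finite_field_power_card[of x] by (simp add: card \<open>m = 3\<close> char2)
    finally show ?thesis using that by (metis char2(3) minus_unique mult_eq_0_iff add.commute)
  qed
  have "\<beta> \<noteq> 1"
  proof
    assume "\<beta> = 1"
    have "\<not> UNIV \<subseteq> {0, 1 :: 'a}"
      using card_mono[of "{0, 1 :: 'a}" UNIV] by (auto simp: card \<open>m = 3\<close>)
    then obtain w :: 'a where w: "w \<noteq> 0" "w \<noteq> 1" by blast
    then have "w ^ 3 + w\<^sup>2 + 1 = 0" using dichotomy root \<open>\<beta> = 1\<close> by blast
    then have "(1 / w) ^ 3 + 1 / w + 1 = 0"
      using w by (simp add: field_simps eval_nat_numeral)
    then show False using root \<open>\<beta> = 1\<close> by blast
  qed
  moreover have "\<beta> ^ 3 + \<beta>\<^sup>2 + 1 \<noteq> 0"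
  proof
    assume z: "\<beta> ^ 3 + \<beta>\<^sup>2 + 1 = 0"
    have "(\<beta>\<^sup>2) ^ 3 + \<beta>\<^sup>2 + \<beta> = (\<beta> ^ 3 + \<beta>\<^sup>2 + 1) * (\<beta> ^ 3 + \<beta>\<^sup>2 + \<beta>)"
      by (simp add: algebra_simps eval_nat_numeral char2)
    then have "(\<beta>\<^sup>2) ^ 3 + \<beta>\<^sup>2 + \<beta> = 0" by (simp only: z mult_zero_left)
    then show False using root by blast
  qed
  ultimately show ?thesis using dichotomy \<open>\<beta> \<noteq> 0\<close> by blast
qed

lemma conjugate_F8:
  fixes \<beta> \<beta>' :: 'a
  assumes "\<beta> ^ 3 + \<beta> + 1 = 0" "\<beta>' ^ 3 + \<beta>' + 1 = 0"
  shows "\<exists>i<3. \<beta>' = \<beta> ^ 2 ^ i"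
proof -
  \<comment> \<open>Modulo the relation for \<open>\<beta>\<close>, the product over its conjugates
    is the cubic evaluated at \<open>\<beta>'\<close>; the last term is the explicit multiple of
    that relation.\<close>
  have "(\<beta>' + \<beta>) * (\<beta>' + \<beta>\<^sup>2) * (\<beta>' + \<beta> ^ 4) = \<beta>' ^ 3 + \<beta>' + 1
    + (\<beta> ^ 3 + \<beta> + 1) * (\<beta>'\<^sup>2 * \<beta> + \<beta>' * (\<beta> ^ 3 + \<beta>\<^sup>2 + \<beta> + 1) + (\<beta> ^ 4 + \<beta>\<^sup>2 + \<beta> + 1))"
    by (simp add: algebra_simps eval_nat_numeral char2)
  then have "\<beta>' + \<beta> = 0 \<or> \<beta>' + \<beta>\<^sup>2 = 0 \<or> \<beta>' + \<beta> ^ 4 = 0" using assms by simp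
  moreover have "x = y" if "x + y = 0" for x y :: 'a using that by (metis char2(3) minus_unique)
  ultimately have "\<beta>' = \<beta> ^ 2 ^ 0 \<or> \<beta>' = \<beta> ^ 2 ^ 1 \<or> \<beta>' = \<beta> ^ 2 ^ 2" by auto
  moreover have "0 < (3::nat)" "1 < (3::nat)" "2 < (3::nat)" by simp_all
  ultimately show ?thesis by blast
qed

section \<open>Sufficiency: conjugate parameters\<close>

text \<open>All coefficients except \<open>\<beta>\<close> equal 1, so the coordinatewise Frobenius
  power, linear over the prime field, carries one graph onto the other.\<close>

lemma ccz_equivalent_taniguchi_frob:
  fixes \<beta> :: 'a
  shows "ccz_equivalent (taniguchi k 1 \<beta>) (taniguchi k 1 (\<beta> ^ 2 ^ i))"
proof -
  let ?F = "\<lambda>p :: 'a \<times> 'a. (fst p ^ 2 ^ i, snd p ^ 2 ^ i)"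
  let ?C = "\<lambda>v :: ('a \<times> 'a) \<times> 'a \<times> 'a. (?F (fst v), ?F (snd v))"
  have F: "taniguchi k 1 (\<beta> ^ 2 ^ i) (?F p) = ?F (taniguchi k 1 \<beta> p)" for p
    by (cases p) (simp add: taniguchi_eq frob_add power_mult_distrib mult.commute[of "2 ^ i" "2 ^ _"] flip: power_mult)
  have F_surj: "\<exists>q. ?F q = p" for p
    using frob_surj[of i "fst p"] frob_surj[of i "snd p"] by (metis fst_conv prod.collapse snd_conv)
  have "inj ?C" by (auto simp: inj_def frob_inj)
  then have "bij ?C" by (simp add: bij_def finite_UNIV_inj_surj)
  moreover have "Vector_Spaces.linear scale2 scale2 ?C"
    unfolding Vector_Spaces.linear_iff using vector_space_scale2_field[OF card]
    by (auto simp: frob_add scale2_def zero_prod_def power_0_left)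
  then have "\<exists>L c. Vector_Spaces.linear scale2 scale2 L \<and> ?C = (\<lambda>v. L v + c)"
    by (intro exI[of _ ?C] exI[of _ 0]) simp
  ultimately have "affine_permutation2 ?C" unfolding affine_permutation2_def by blast
  moreover have "?C ` fun_graph (taniguchi k 1 \<beta>) = fun_graph (taniguchi k 1 (\<beta> ^ 2 ^ i))"
  proof (intro equalityI subsetI)
    fix z assume "z \<in> ?C ` fun_graph (taniguchi k 1 \<beta>)"
    then obtain p where "z = (?F p, ?F (taniguchi k 1 \<beta> p))" by (auto simp: fun_graph_def)
    then have "z = (?F p, taniguchi k 1 (\<beta> ^ 2 ^ i) (?F p))" by (simp only: F)
    then show "z \<in> fun_graph (taniguchi k 1 (\<beta> ^ 2 ^ i))" unfolding fun_graph_def by blast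
  next
    fix z assume "z \<in> fun_graph (taniguchi k 1 (\<beta> ^ 2 ^ i))"
    then obtain p where z: "z = (p, taniguchi k 1 (\<beta> ^ 2 ^ i) p)" by (auto simp: fun_graph_def)
    obtain q where "?F q = p" using F_surj by blast
    then have "z = ?C (q, taniguchi k 1 \<beta> q)" using z F[of q] by simp
    then show "z \<in> ?C ` fun_graph (taniguchi k 1 \<beta>)" unfolding fun_graph_def by blast
  qed
  ultimately show ?thesis unfolding ccz_equivalent_def by blast
qed

end

theorem theorem4p5:
  fixes m k l :: nat
    and \<beta> \<beta>' :: "'a::{finite, field}"
  assumes "CARD('a) = 2 ^ m"
    and "m \<ge> 3"
    and "0 < k" and "2 * k < m" and "coprime k m"
    and "0 < l" and "2 * l < m" and "coprime l m"
    and "\<beta> \<noteq> 0" and "\<beta>' \<noteq> 0"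
    and "\<nexists>x. poly (taniguchi_poly k 1 \<beta>) x = 0"
    and "\<nexists>x. poly (taniguchi_poly l 1 \<beta>') x = 0"
  shows "ccz_equivalent (taniguchi k 1 \<beta>) (taniguchi l 1 \<beta>')
         \<longleftrightarrow> k = l \<and> (\<exists>i\<in>{0..m - 1}. \<beta>' = \<beta> ^ (2 ^ i))"
proof -
  have root: "x ^ (2 ^ k + 1) + x + \<beta> \<noteq> 0" "x ^ (2 ^ l + 1) + x + \<beta>' \<noteq> 0" for x
    using assms(11,12) by (auto simp: taniguchi_poly_def poly_monom)
  have range: "i \<in> {0..m - 1} \<longleftrightarrow> i < m" for i using assms(2) by auto
  have "k = l \<and> (\<exists>i<m. \<beta>' = \<beta> ^ 2 ^ i)"
    if ccz: "ccz_equivalent (taniguchi k 1 \<beta>) (taniguchi l 1 \<beta>')"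
  proof (cases "m = 3")
    case True
    \<comment> \<open>From \<open>2 * k < 3\<close> and \<open>2 * l < 3\<close>. Both parameters
      are then roots of the same cubic, hence conjugate.\<close>
    then have "k = 1" "l = 1" using assms by auto
    then show ?thesis
      using conjugate_F8[OF assms(1) no_root_F8[OF assms(1) True assms(9)] no_root_F8[OF assms(1) True assms(10)]]
        root True by simp
  next
    case False
    then have m: "3 < m" "2 \<le> m" using assms by auto
    show ?thesis
    proof (rule ccz_equivalent_taniguchi_imp_linear[OF assms(1) m(2) assms(8) root(2) ccz])
      fix L N :: "'a \<times> 'a \<Rightarrow> 'a \<times> 'a"
      assume "bij L" "\<And>p r. L (p + r) = L p + L r" "\<And>p r. N (p + r) = N p + N r"
        "\<And>p r. taniguchi_form l \<beta>' (L p) (L r) = N (taniguchi_form k \<beta> p r)"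
      then show ?thesis
        by (rule taniguchi_linear_equivalence[OF assms(1) m(1) assms(3-5,9,6,7,10)])
    qed
  qed
  then show ?thesis
    using ccz_equivalent_taniguchi_frob[OF assms(1)] unfolding range Bex_def by blast
qed

end
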